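(* Let $k$ be a field of characteristic not $2$, let $\mathfrak C$ be an octonion algebra over $k$, and let $G=\mathrm{Aut}(\mathfrak C)$. Let $t_0\in G(k)$ be a semisimple element that fixes pointwise a quadratic étale subalgebra $L$ of $\mathfrak C$. Let $A$ denote the image of $t_0$ in $SU(L^\perp,h)$ if $L$ is a field, respectively in $SL(U)\cong SL(3)$ if $L\cong k\times k$. Assume that the characteristic polynomial of $A$ (over $L$ in the first case, over $k$ in the second case) is reducible. Then $t_0$ is a product of two involutions in $G(k)$.
   Context: An octonion algebra over $k$ is an $8$-dimensional unital $k$-algebra $\mathfrak C$ (not associative) with a nondegenerate quadratic form $N$ (with associated bilinear form $N(x,y)=N(x+y)-N(x)-N(y)$) satisfying $N(xy)=N(x)N(y)$. A quadratic étale subalgebra $L$ is a $2$-dimensional subalgebra on which $N$ is nondegenerate; it is either a quadratic field extension of $k$ or isomorphic to $k\times k$. An involution in $G(k)$ is an element $g$ with $g^2=1$. If $L=k(\gamma)$, $\gamma^2=c\in k^*$, is a field, then $L^\perp$ (orthogonal complement with respect to $N$) is a $3$-dimensional left $L$-vector space via multiplication in $\mathfrak C$, with the nondegenerate hermitian form $h(x,y)=N(x,y)+\gamma^{-1}N(\gamma x,y)$; restriction $t\mapsto t|_{L^\perp}$ identifies the group of automorphisms of $\mathfrak C$ fixing $L$ pointwise with $SU(L^\perp,h)$. If $L\cong k\times k$ and $e\in L$ is a nontrivial idempotent, put $U=\{x\in\mathfrak C: ex=0,\ xe=x\}$, a $3$-dimensional $k$-space; then $t\mapsto t|_U$ identifies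 the group of automorphisms of $\mathfrak C$ fixing $L$ pointwise with $SL(U)$. *)

theory Defs
  imports
    "Jordan_Normal_Form.VS_Connect"
    "HOL-Algebra.Polynomials"
    "HOL-Algebra.Algebraic_Closure_Type"
begin

section \<open>Endomorphisms and matrices over a ring given by a record\<close>

text \<open>
  Characteristic polynomials are needed over \<open>k\<close>, which is a type, and over a quadratic subfield
  of the octonion algebra, which is only a subset of a type. Both are therefore treated as
  \<^theory>\<open>HOL-Algebra.Ring\<close> records, \<open>k\<close> through \<^term>\<open>class_ring\<close>.
\<close>

text \<open>The multiplication of a module is irrelevant, as in \<^term>\<open>module_vec\<close>.\<close>

definition additive_module :: "('r \<Rightarrow> 'v \<Rightarrow> 'v) \<Rightarrow> 'v set \<Rightarrow> ('r, 'v::ab_group_add) module" where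
  "additive_module smul V =
     \<lparr>carrier = V, monoid.mult = undefined, one = undefined, ring.zero = 0, add = (+),
      module.smult = smul\<rparr>"

text \<open>The images of the basis vectors are the columns of the matrix.\<close>

definition represents ::
  "'r ring \<Rightarrow> ('r \<Rightarrow> 'v \<Rightarrow> 'v) \<Rightarrow> 'v set \<Rightarrow> ('v::ab_group_add \<Rightarrow> 'v) \<Rightarrow> 'v list \<Rightarrow> 'r mat \<Rightarrow> bool" where
  "represents K smul V f vs A \<longleftrightarrow>
     distinct vs \<and>
     vectorspace.basis K (additive_module smul V) (set vs) \<and>
     A \<in> carrier_mat (length vs) (length vs) \<and>
     elements_mat A \<subseteq> carrier K \<and>
     (\<forall>j<length vs. f (vs ! j) = (\<Sum>i<length vs. smul (A $$ (i, j)) (vs ! i)))"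

definition det_over :: "('r, 'm) ring_scheme \<Rightarrow> 'r mat \<Rightarrow> 'r" where
  "det_over R A =
     (\<Oplus>\<^bsub>R\<^esub>p\<in>{p. p permutes {0..<dim_row A}}.
        (if evenperm p then \<one>\<^bsub>R\<^esub> else \<ominus>\<^bsub>R\<^esub> \<one>\<^bsub>R\<^esub>) \<otimes>\<^bsub>R\<^esub> (\<Otimes>\<^bsub>R\<^esub>i\<in>{0..<dim_row A}. A $$ (i, p i)))"

text \<open>\<open>det (X I - A)\<close>, computed in the polynomial ring over \<open>K\<close>.\<close>

definition char_poly_over :: "'r ring \<Rightarrow> 'r mat \<Rightarrow> 'r list" where
  "char_poly_over K A =
     (let P = univ_poly K (carrier K) in
      det_over P (mat (dim_row A) (dim_row A)
        (\<lambda>(i, j). (if i = j then X\<^bsub>K\<^esub> else \<zero>\<^bsub>P\<^esub>) \<ominus>\<^bsub>P\<^esub> ring.poly_of_const K (A $$ (i, j)))))"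

text \<open>The polynomial does not depend on the choice of \<open>vs\<close>.\<close>

definition is_char_poly ::
  "'r ring \<Rightarrow> ('r \<Rightarrow> 'v \<Rightarrow> 'v) \<Rightarrow> 'v set \<Rightarrow> ('v::ab_group_add \<Rightarrow> 'v) \<Rightarrow> 'r list \<Rightarrow> bool" where
  "is_char_poly K smul V f p \<longleftrightarrow> (\<exists>vs A. represents K smul V f vs A \<and> p = char_poly_over K A)"

text \<open>
  A reducible polynomial is one that factors into two nonconstant polynomials. Nonzero constants
  are units and hence also fail to be irreducible, so they have to be excluded.
\<close>

definition reducible_poly :: "'r ring \<Rightarrow> 'r list \<Rightarrow> bool" where
  "reducible_poly K p \<longleftrightarrow>
     (let P = univ_poly K (carrier K) in
      p \<in> carrier P \<and> p \<noteq> \<zero>\<^bsub>P\<^esub> \<and> p \<notin> Units P \<and> \<not> ring_irreducible\<^bsub>P\<^esub> p)"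

text \<open>
  Semisimplicity is the geometric notion: diagonalizable over the algebraic closure. Over an
  imperfect field this is stronger than every invariant subspace having an invariant complement.
\<close>

definition semisimple_endo ::
  "('k::field \<Rightarrow> 'v \<Rightarrow> 'v) \<Rightarrow> ('v::ab_group_add \<Rightarrow> 'v) \<Rightarrow> bool" where
  "semisimple_endo smul f \<longleftrightarrow>
     (\<exists>vs A D. represents class_ring smul UNIV f vs A \<and>
        similar_mat (map_mat to_ac A) D \<and> diagonal_mat D)"


section \<open>Octonion algebras\<close>

locale octonion_algebra = vector_space scale
  for scale :: "'k::field \<Rightarrow> 'c::ab_group_add \<Rightarrow> 'c" (infixr "*\<^sub>k" 75) +
  fixes mul :: "'c \<Rightarrow> 'c \<Rightarrow> 'c" (infixl "\<star>" 70)
    and e1 :: 'c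
    and N :: "'c \<Rightarrow> 'k"
  assumes dim_8: "dim UNIV = 8"
    and linear_mul_left: "Vector_Spaces.linear scale scale (\<lambda>y. x \<star> y)"
    and linear_mul_right: "Vector_Spaces.linear scale scale (\<lambda>y. y \<star> x)"
    and unit_left: "e1 \<star> x = x"
    and unit_right: "x \<star> e1 = x"
    and N_scale: "N (a *\<^sub>k x) = a\<^sup>2 * N x"
    and N_polar_linear: "Vector_Spaces.linear scale (*) (\<lambda>y. N (x + y) - N x - N y)"
    and N_nondegenerate: "(\<forall>y. N (x + y) - N x - N y = 0) \<Longrightarrow> x = 0"
    and N_mult: "N (x \<star> y) = N x * N y"
begin

definition polar :: "'c \<Rightarrow> 'c \<Rightarrow> 'k" where
  "polar x y = N (x + y) - N x - N y"

definition Aut :: "('c \<Rightarrow> 'c) set" where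
  "Aut = {f. Vector_Spaces.linear scale scale f \<and> bij f \<and> f e1 = e1 \<and>
             (\<forall>x y. f (x \<star> y) = f x \<star> f y)}"

text \<open>The identity counts as an involution.\<close>

definition involution :: "('c \<Rightarrow> 'c) \<Rightarrow> bool" where
  "involution g \<longleftrightarrow> g \<in> Aut \<and> g \<circ> g = id"

definition quadratic_etale :: "'c set \<Rightarrow> bool" where
  "quadratic_etale L \<longleftrightarrow>
     subspace L \<and> dim L = 2 \<and> e1 \<in> L \<and> (\<forall>x\<in>L. \<forall>y\<in>L. x \<star> y \<in> L) \<and>
     (\<forall>x\<in>L. (\<forall>y\<in>L. polar x y = 0) \<longrightarrow> x = 0)"

definition subalgebra_ring :: "'c set \<Rightarrow> 'c ring" where
  "subalgebra_ring L = \<lparr>carrier = L, monoid.mult = (\<star>), one = e1, ring.zero = 0, add = (+)\<rparr>"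

text \<open>\<open>\<phi>\<close> is an isomorphism of \<open>k\<close>-algebras from \<open>k \<times> k\<close> onto \<open>L\<close>.\<close>

definition split_algebra :: "'c set \<Rightarrow> bool" where
  "split_algebra L \<longleftrightarrow>
     (\<exists>\<phi> :: 'k \<times> 'k \<Rightarrow> 'c. bij_betw \<phi> UNIV L \<and> \<phi> (1, 1) = e1 \<and>
        (\<forall>a b c d. \<phi> (a + c, b + d) = \<phi> (a, b) + \<phi> (c, d)) \<and>
        (\<forall>a b c. \<phi> (c * a, c * b) = c *\<^sub>k \<phi> (a, b)) \<and>
        (\<forall>a b c d. \<phi> (a * c, b * d) = \<phi> (a, b) \<star> \<phi> (c, d)))"

definition orth :: "'c set \<Rightarrow> 'c set" where
  "orth L = {x. \<forall>y\<in>L. polar x y = 0}"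

definition nontrivial_idempotent :: "'c \<Rightarrow> bool" where
  "nontrivial_idempotent e \<longleftrightarrow> e \<star> e = e \<and> e \<noteq> 0 \<and> e \<noteq> e1"

definition U_space :: "'c \<Rightarrow> 'c set" where
  "U_space e = {x. e \<star> x = 0 \<and> x \<star> e = x}"

end

end

theory Submission
  imports Defs "HOL-Algebra.Polynomial_Divisibility"
begin

text \<open>
  An eigenvector \<open>v \<in> L\<^sup>\<bottom>\<close> of \<open>t\<close> over \<open>L\<close> with \<open>N v \<noteq> 0\<close> makes the quaternion subalgebra
  \<open>M = L + L v\<close> invariant under \<open>t\<close>. Writing \<open>\<CC> = M + M w\<close> with \<open>w \<in> M\<^sup>\<bottom>\<close>, one finds
  \<open>t (x + y w) = c x c\<inverse> + (d y c\<inverse>) w\<close> for some \<open>c \<in> L\<close>, \<open>d \<in> M\<close> of equal norm. Such maps multiply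
  componentwise in \<open>(c, d)\<close>, and the one belonging to \<open>(q, z)\<close> is an involution if \<open>q\<close> and \<open>z\<close> have
  trace zero. So it suffices to find \<open>q \<in> L v\<close> and \<open>z \<in> M\<close> of equal nonzero norm for which \<open>z\<close>
  and \<open>z d\<close> have trace zero (\<open>q\<close> and \<open>q c\<close> then have trace zero as well).

  A reducible cubic has a root, so reducibility provides an eigenvector. If it is isotropic, then
  semisimplicity provides a second one that is not orthogonal to it. From the two one obtains an
  anisotropic eigenvector: their sum if \<open>L\<close> is split (with eigenvalue in \<open>L = k \<times> k\<close>), their cross
  product if \<open>L\<close> is a field.
\<close>

section \<open>Eigenvalues from reducible characteristic polynomials\<close>

text \<open>The form of \<open>t\<close> rests on two norm computations. On \<open>M\<close> it
  fixes \<open>L\<close> and sends \<open>v\<close> to \<open>a v\<close> with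
  \<open>N a = 1\<close>; by Hilbert 90 \<open>a\<close> is the quotient of some \<open>c\<close> in
  \<open>L\<close> by its conjugate, which makes \<open>t\<close> on \<open>M\<close> conjugation by
  \<open>c\<close>. On the complement \<open>M w\<close> it sends \<open>w\<close> to
  \<open>p w\<close> with \<open>N p = 1\<close>, and \<open>d = p c\<close>. Taking
  \<open>q\<close> in \<open>L v\<close> settles the traces of \<open>q\<close> and
  \<open>q c\<close> at once, because \<open>L v\<close> is orthogonal to \<open>L\<close>. What
  remains is one linear condition on a trace-zero \<open>z\<close> and an equality of norms, a
  question about quadratic forms.

  Two obstacles shape the rest. If \<open>L\<close> is a field, it is a subset and not a type, so
  determinants live over a record and are tested only after embedding \<open>L\<close> into the
  algebraic closure of \<open>k\<close>. And semisimplicity speaks about \<open>t\<close> over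
  \<open>k\<close> on the whole algebra, whereas eigenvectors are wanted over \<open>L\<close>
  inside \<open>orth L\<close>. Only its consequence for polynomials of degree at most 2 over
  \<open>k\<close> is extracted; this suffices because every element of \<open>L\<close> is a root
  of such a polynomial.\<close>

context
  fixes K :: "'r ring" and smul :: "'r \<Rightarrow> 'v::ab_group_add \<Rightarrow> 'v" and V :: "'v set"
  assumes vs: "vectorspace K (additive_module smul V)"
begin

interpretation vectorspace K "additive_module smul V" by (fact vs)

lemma additive_module_simps:
  "carrier (additive_module smul V) = V"
  "add (additive_module smul V) = (+)"
  "zero (additive_module smul V) = 0"
  "module.smult (additive_module smul V) = smul"
  by (simp_all add: additive_module_def)

lemma additive_module_closed:
  "0 \<in> V" "x \<in> V \<Longrightarrow> y \<in> V \<Longrightarrow> x + y \<in> V" "a \<in> carrier K \<Longrightarrow> x \<in> V \<Longrightarrow> smul a x \<in> V"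
  using M.zero_closed M.a_closed[of x y] smult_closed[of a x]
  by (simp_all add: additive_module_simps)

lemma additive_module_smul:
  "a \<in> carrier K \<Longrightarrow> x \<in> V \<Longrightarrow> y \<in> V \<Longrightarrow> smul a (x + y) = smul a x + smul a y"
  "a \<in> carrier K \<Longrightarrow> b \<in> carrier K \<Longrightarrow> x \<in> V \<Longrightarrow> smul (a \<oplus>\<^bsub>K\<^esub> b) x = smul a x + smul b x"
  "a \<in> carrier K \<Longrightarrow> b \<in> carrier K \<Longrightarrow> x \<in> V \<Longrightarrow> smul (a \<otimes>\<^bsub>K\<^esub> b) x = smul a (smul b x)"
  "x \<in> V \<Longrightarrow> smul \<one>\<^bsub>K\<^esub> x = x"
  "x \<in> V \<Longrightarrow> smul \<zero>\<^bsub>K\<^esub> x = 0"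
  using smult_r_distr[of a x y] smult_l_distr[of a b x] smult_assoc1[of a b x] smult_one[of x]
    lmult_0[of x]
  by (simp_all add: additive_module_simps)

lemma smul_zero: "a \<in> carrier K \<Longrightarrow> smul a 0 = 0"
  using additive_module_smul(1)[of a 0 0] additive_module_closed(1) by simp

lemma sum_closed: "(\<And>i. i \<in> I \<Longrightarrow> g i \<in> V) \<Longrightarrow> sum g I \<in> V"
  by (induction I rule: infinite_finite_induct) (auto simp: additive_module_closed)

lemma smul_sum: "a \<in> carrier K \<Longrightarrow> (\<And>i. i \<in> I \<Longrightarrow> g i \<in> V) \<Longrightarrow> smul a (sum g I) = (\<Sum>i\<in>I. smul a (g i))"
  by (induction I rule: infinite_finite_induct)
    (auto simp: smul_zero additive_module_smul sum_closed)

lemma finsum_smul: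
  assumes "finite I" "\<And>i. i \<in> I \<Longrightarrow> g i \<in> carrier K" "x \<in> V"
  shows "smul (finsum K g I) x = (\<Sum>i\<in>I. smul (g i) x)"
  using assms by (induction I) (simp_all add: additive_module_smul Pi_def R.finsum_closed)

lemma finsum_additive_module:
  assumes "finite I" "\<And>i. i \<in> I \<Longrightarrow> g i \<in> V"
  shows "finsum (additive_module smul V) g I = sum g I"
  using assms by (induction I) (simp_all add: additive_module_simps Pi_def)

context
  fixes us
  assumes basis: "basis (set us)" and dist: "distinct us"
begin

lemma basis_in: "i < length us \<Longrightarrow> us ! i \<in> V"
  using basis nth_mem[of i us] unfolding basis_def by (auto simp: additive_module_simps)

lemma lincomb_list:
  assumes "\<And>v. v \<in> set us \<Longrightarrow> a v \<in> carrier K"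
  shows "lincomb a (set us) = (\<Sum>i<length us. smul (a (us ! i)) (us ! i))"
proof -
  have "lincomb a (set us) = (\<Sum>v\<in>set us. smul (a v) v)"
    unfolding lincomb_def additive_module_simps
    using assms basis by (intro finsum_additive_module)
      (auto simp: additive_module_simps basis_def intro!: additive_module_closed)
  also have "\<dots> = (\<Sum>i<length us. smul (a (us ! i)) (us ! i))"
    by (rule sum.reindex_bij_betw[symmetric]) (rule bij_betw_nth[OF dist], auto)
  finally show ?thesis .
qed

lemma basis_spans:
  assumes "x \<in> V"
  obtains c where "\<And>i. c i \<in> carrier K" "x = (\<Sum>i<length us. smul (c i) (us ! i))"
proof -
  have "x \<in> span (set us)" "set us \<subseteq> V" using basis assms unfolding basis_def by (auto simp: additive_module_simps)
  then obtain a where a: "a \<in> set us \<rightarrow> carrier K" "x = lincomb a (set us)"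
    using finite_span[of "set us"] by (auto simp: additive_module_simps)
  define c where "c i = (if i < length us then a (us ! i) else \<zero>\<^bsub>K\<^esub>)" for i
  have "c i \<in> carrier K" for i using a(1) by (auto simp: c_def)
  moreover have "x = (\<Sum>i<length us. smul (c i) (us ! i))"
    using a lincomb_list[of a] by (auto simp: c_def)
  ultimately show thesis by (rule that)
qed

lemma basis_independent:
  assumes c: "\<And>i. i < length us \<Longrightarrow> c i \<in> carrier K" and z: "(\<Sum>i<length us. smul (c i) (us ! i)) = 0"
    and i: "i < length us"
  shows "c i = \<zero>\<^bsub>K\<^esub>"
proof -
  define a where "a v = c (THE i. i < length us \<and> us ! i = v)" for v
  have a: "a (us ! i) = c i" if "i < length us" for i
  proof -
    have "(THE j. j < length us \<and> us ! j = us ! i) = i"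
      using that dist by (intro the_equality) (auto simp: nth_eq_iff_index_eq)
    then show ?thesis by (simp add: a_def)
  qed
  have acar: "a v \<in> carrier K" if "v \<in> set us" for v
    using that c a by (auto simp: in_set_conv_nth)
  have "lincomb a (set us) = \<zero>\<^bsub>additive_module smul V\<^esub>"
    using lincomb_list[OF acar] z a by (simp add: additive_module_simps)
  moreover have "\<not> lin_dep (set us)" using basis by (simp add: basis_def)
  moreover have "a \<in> set us \<rightarrow> carrier K" using acar by auto
  ultimately have "a (us ! i) = \<zero>\<^bsub>K\<^esub>"
    using nth_mem[OF i] unfolding lin_dep_def by blast
  then show ?thesis using a[OF i] by simp
qed

end
end

text \<open>A ring homomorphism commutes with the Leibniz formula. This is the bridge from
  \<open>det_over\<close> to \<open>det\<close> over a type, where multiplicativity of determinants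
  is at hand.\<close>

lemma det_over_hom:
  fixes h :: "'r \<Rightarrow> 'f::comm_ring_1"
  assumes R: "cring R" and h: "h \<in> Ring.ring_hom R class_ring"
    and A: "A \<in> carrier_mat n n" and entries: "\<And>i j. i < n \<Longrightarrow> j < n \<Longrightarrow> A $$ (i, j) \<in> carrier R"
  shows "h (det_over R A) = det (map_mat h A)"
proof -
  interpret R: cring R by (fact R)
  interpret h: ring_hom_cring R "class_ring :: 'f ring" h
    by (intro ring_hom_cring.intro ring_hom_cring_axioms.intro R class_cring.is_cring h)
  have p: "p i < n" if "p permutes {0..<n}" "i < n" for p i
    using permutes_in_image[OF that(1), of i] that(2) by simp
  have prods: "(\<lambda>i. A $$ (i, p i)) \<in> {0..<n} \<rightarrow> carrier R" if "p permutes {0..<n}" for p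
    using entries p[OF that] by auto
  have "h (det_over R A) = (\<Sum>p\<in>{p. p permutes {0..<n}}.
      h ((if evenperm p then \<one>\<^bsub>R\<^esub> else \<ominus>\<^bsub>R\<^esub> \<one>\<^bsub>R\<^esub>) \<otimes>\<^bsub>R\<^esub> (\<Otimes>\<^bsub>R\<^esub>i\<in>{0..<n}. A $$ (i, p i))))"
    unfolding det_over_def using A prods
    by (subst h.hom_finsum) (auto simp: class_ring_simps o_def intro!: R.finprod_closed)
  also have "\<dots> = (\<Sum>p\<in>{p. p permutes {0..<n}}. signof p * (\<Prod>i=0..<n. map_mat h A $$ (i, p i)))"
  proof (rule sum.cong)
    fix p assume "p \<in> {p. p permutes {0..<n}}"
    then have per: "p permutes {0..<n}" by simp
    have "h (\<Otimes>\<^bsub>R\<^esub>i\<in>{0..<n}. A $$ (i, p i)) = (\<Prod>i=0..<n. map_mat h A $$ (i, p i))"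
      using h.hom_finprod[OF prods[OF per]] A p[OF per] by (simp add: class_ring_simps o_def)
    moreover have "h (if evenperm p then \<one>\<^bsub>R\<^esub> else \<ominus>\<^bsub>R\<^esub> \<one>\<^bsub>R\<^esub>) = signof p"
      using h.hom_one by (simp add: class_ring_simps sign_def)
    ultimately show "h ((if evenperm p then \<one>\<^bsub>R\<^esub> else \<ominus>\<^bsub>R\<^esub> \<one>\<^bsub>R\<^esub>) \<otimes>\<^bsub>R\<^esub> (\<Otimes>\<^bsub>R\<^esub>i\<in>{0..<n}. A $$ (i, p i))) =
        signof p * (\<Prod>i=0..<n. map_mat h A $$ (i, p i))"
      using prods[OF per] by (subst h.hom_mult) (auto intro!: R.finprod_closed)
  qed simp
  also have "\<dots> = det (map_mat h A)"
    using A by (simp add: det_def')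
  finally show ?thesis .
qed

section \<open>Degrees and roots of polynomials over a field given by a record\<close>

context field
begin

lemma univ_poly_field_cring: "cring (univ_poly R (carrier R))"
  using univ_poly_is_cring[OF carrier_is_subring] .

text \<open>Only an inequality, because the zero polynomial \<open>[]\<close> has degree 0 and
  equality fails when exactly one factor vanishes and the other is not constant.\<close>

lemma degree_univ_poly_mult_le:
  assumes "p \<in> carrier (poly_ring R)" "q \<in> carrier (poly_ring R)"
  shows "degree (p \<otimes>\<^bsub>poly_ring R\<^esub> q) \<le> degree p + degree q"
  using poly_mult_degree_eq[OF carrier_is_subring, of p q] assms
  unfolding univ_poly_mult univ_poly_carrier[symmetric] by auto

lemma degree_finprod_le:
  assumes "finite I" "\<And>i. i \<in> I \<Longrightarrow> g i \<in> carrier (poly_ring R)" "\<And>i. i \<in> I \<Longrightarrow> degree (g i) \<le> 1"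
  shows "degree (finprod (poly_ring R) g I) \<le> card I"
proof -
  interpret P: cring "poly_ring R" by (rule univ_poly_field_cring)
  show ?thesis using assms
  proof (induction I)
    case empty
    then show ?case by (simp add: univ_poly_one)
  next
    case (insert i I)
    then have "degree (g i \<otimes>\<^bsub>poly_ring R\<^esub> finprod (poly_ring R) g I) \<le> degree (g i) + degree (finprod (poly_ring R) g I)"
      by (intro degree_univ_poly_mult_le) (auto intro!: P.finprod_closed)
    also have "\<dots> \<le> Suc (card I)" using insert by fastforce
    finally show ?case using insert by (simp add: P.finprod_insert Pi_def)
  qed
qed

lemma degree_finsum_le:
  assumes "finite I" "\<And>i. i \<in> I \<Longrightarrow> g i \<in> carrier (poly_ring R)" "\<And>i. i \<in> I \<Longrightarrow> degree (g i) \<le> n"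
  shows "degree (finsum (poly_ring R) g I) \<le> n"
proof -
  interpret P: cring "poly_ring R" by (rule univ_poly_field_cring)
  show ?thesis using assms
  proof (induction I)
    case empty
    then show ?case by (simp add: univ_poly_zero)
  next
    case (insert i I)
    have "degree (g i \<oplus>\<^bsub>poly_ring R\<^esub> finsum (poly_ring R) g I) \<le> max (degree (g i)) (degree (finsum (poly_ring R) g I))"
      unfolding univ_poly_add by (rule poly_add_degree)
    also have "\<dots> \<le> n" using insert by simp
    finally show ?case using insert by (simp add: P.finsum_insert Pi_def)
  qed
qed

lemma degree_det_over_le:
  assumes A: "A \<in> carrier_mat n n"
    and entries: "\<And>i j. i < n \<Longrightarrow> j < n \<Longrightarrow> A $$ (i, j) \<in> carrier (poly_ring R)"
    and deg: "\<And>i j. i < n \<Longrightarrow> j < n \<Longrightarrow> degree (A $$ (i, j)) \<le> 1"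
  shows "degree (det_over (poly_ring R) A) \<le> n"
proof -
  interpret P: cring "poly_ring R" by (rule univ_poly_field_cring)
  let ?s = "\<lambda>p. if evenperm p then \<one>\<^bsub>poly_ring R\<^esub> else \<ominus>\<^bsub>poly_ring R\<^esub> \<one>\<^bsub>poly_ring R\<^esub>"
  have s: "?s p \<in> carrier (poly_ring R)" for p
    by simp
  have deg_s: "degree (?s p) = 0" for p
  proof -
    have "degree \<one>\<^bsub>poly_ring R\<^esub> = 0" by (simp add: univ_poly_one)
    then show ?thesis
      using univ_poly_a_inv_degree[OF carrier_is_subring P.one_closed] by (simp split: if_split)
  qed
  show ?thesis
    unfolding det_over_def
  proof (rule degree_finsum_le)
    show "finite {p. p permutes {0..<dim_row A}}" by (rule finite_permutations) simp
    fix p assume "p \<in> {p. p permutes {0..<dim_row A}}"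
    then have p: "p i < n" if "i < n" for i
      using permutes_in_image[of p "{0..<n}" i] that A by simp
    have prod: "finprod (poly_ring R) (\<lambda>i. A $$ (i, p i)) {0..<dim_row A} \<in> carrier (poly_ring R)"
      using A p entries by (intro P.finprod_closed) auto
    show "?s p \<otimes>\<^bsub>poly_ring R\<^esub> finprod (poly_ring R) (\<lambda>i. A $$ (i, p i)) {0..<dim_row A} \<in> carrier (poly_ring R)"
      using s prod by (rule P.m_closed)
    have "degree (finprod (poly_ring R) (\<lambda>i. A $$ (i, p i)) {0..<dim_row A}) \<le> card {0..<dim_row A}"
      using A p entries deg by (intro degree_finprod_le) auto
    then show "degree (?s p \<otimes>\<^bsub>poly_ring R\<^esub> finprod (poly_ring R) (\<lambda>i. A $$ (i, p i)) {0..<dim_row A}) \<le> n"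
      using degree_univ_poly_mult_le[OF s prod, of p] deg_s[of p] A by simp
  qed
qed

end

text \<open>Two nonunit factors have positive degrees with sum at most 3, so one of them is linear.
  The upper bound on the degree is enough, so a characteristic polynomial never has to be shown
  monic of degree 3.\<close>

lemma reducible_cubic_has_root:
  fixes K :: "'r ring"
  assumes K: "field K" and red: "reducible_poly K p" and deg: "Polynomials.degree p \<le> 3"
  obtains a where "a \<in> carrier K" "ring.eval K p a = \<zero>\<^bsub>K\<^esub>"
proof -
  interpret field K by (fact K)
  interpret P: domain "poly_ring K" by (rule univ_poly_is_domain[OF carrier_is_subring])
  have p: "p \<in> carrier (poly_ring K)" "p \<noteq> \<zero>\<^bsub>poly_ring K\<^esub>" "p \<notin> Units (poly_ring K)"
    "\<not> ring_irreducible\<^bsub>poly_ring K\<^esub> p"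
    using red by (auto simp: reducible_poly_def Let_def)
  then obtain q r where qr: "q \<in> carrier (poly_ring K)" "r \<in> carrier (poly_ring K)"
    "p = q \<otimes>\<^bsub>poly_ring K\<^esub> r" "q \<notin> Units (poly_ring K)" "r \<notin> Units (poly_ring K)"
    using P.ring_irreducibleI[of p] by blast
  have nz: "q \<noteq> []" "r \<noteq> []" using p(1,2) qr by (auto simp flip: univ_poly_zero[of K "carrier K"])
  have "Polynomials.degree q \<noteq> 0" "Polynomials.degree r \<noteq> 0"
    using univ_poly_units'[OF carrier_is_subfield] qr nz by auto
  moreover have "Polynomials.degree p = Polynomials.degree q + Polynomials.degree r"
    using poly_mult_degree_eq[OF carrier_is_subring, of q r] qr nz
    unfolding univ_poly_mult univ_poly_carrier[symmetric] by auto
  ultimately have "Polynomials.degree q = 1 \<or> Polynomials.degree r = 1" using deg by linarith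
  moreover have root: "\<exists>a\<in>carrier K. eval s a = \<zero>\<^bsub>K\<^esub>" if "s \<in> carrier (poly_ring K)" "Polynomials.degree s = 1" for s
    using degree_one_root[OF carrier_is_subfield that] by blast
  moreover have "eval p a = eval q a \<otimes>\<^bsub>K\<^esub> eval r a" if "a \<in> carrier K" for a
    using eval_poly_mult[of q r a] qr that polynomial_incl[of "carrier K"]
    unfolding univ_poly_mult univ_poly_carrier[symmetric] by simp
  moreover have "eval s a \<in> carrier K" if "s \<in> carrier (poly_ring K)" "a \<in> carrier K" for s a
    using eval_poly_in_carrier[OF carrier_is_subring] that by (simp add: univ_poly_carrier)
  ultimately show thesis using that qr(1,2) by (metis l_null r_null)
qed

text \<open>Evaluation at \<open>a\<close> followed by \<open>h\<close> is a ring homomorphism on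
  the polynomial ring, so \<open>det_over_hom\<close> moves it inside the determinant.\<close>

lemma char_poly_over_degree_and_eval:
  fixes K :: "'r ring" and h :: "'r \<Rightarrow> 'f::field"
  assumes K: "field K" and h: "h \<in> Ring.ring_hom K class_ring"
    and A: "A \<in> carrier_mat n n" "elements_mat A \<subseteq> carrier K"
  shows "Polynomials.degree (char_poly_over K A) \<le> n"
    and "a \<in> carrier K \<Longrightarrow> h (ring.eval K (char_poly_over K A) a) =
      det (mat n n (\<lambda>(i, j). (if i = j then h a else 0) - h (A $$ (i, j))))"
proof -
  interpret field K by (fact K)
  interpret P: cring "poly_ring K" by (rule univ_poly_field_cring)
  define B where "B = mat n n (\<lambda>(i, j). (if i = j then X\<^bsub>K\<^esub> else \<zero>\<^bsub>poly_ring K\<^esub>)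
    \<ominus>\<^bsub>poly_ring K\<^esub> poly_of_const (A $$ (i, j)))"
  have B: "char_poly_over K A = det_over (poly_ring K) B"
    using A by (simp add: char_poly_over_def Let_def B_def)
  have Acar: "A $$ (i, j) \<in> carrier K" if "i < n" "j < n" for i j
    using elements_matI[OF A(1) that refl] A(2) by blast
  have const: "poly_of_const c \<in> carrier (poly_ring K)" "Polynomials.degree (poly_of_const c) = 0"
    "eval (poly_of_const c) b = c"
    if "c \<in> carrier K" "b \<in> carrier K" for b c
    using that by (auto simp: poly_of_const_def polynomial_def simp flip: univ_poly_carrier)
  have X: "X\<^bsub>K\<^esub> \<in> carrier (poly_ring K)" "Polynomials.degree X\<^bsub>K\<^esub> = 1"
    using var_closed(1)[OF carrier_is_subring] by (simp_all add: var_def)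
  have Bcar: "B $$ (i, j) \<in> carrier (poly_ring K)" if "i < n" "j < n" for i j
    using that Acar const(1)[OF _ zero_closed] X by (auto simp: B_def)
  have Bdeg: "Polynomials.degree (B $$ (i, j)) \<le> 1" if "i < n" "j < n" for i j
  proof -
    have c: "poly_of_const (A $$ (i, j)) \<in> carrier (poly_ring K)"
      "Polynomials.degree (poly_of_const (A $$ (i, j))) = 0"
      using const Acar[OF that] zero_closed by blast+
    have "Polynomials.degree (p \<ominus>\<^bsub>poly_ring K\<^esub> poly_of_const (A $$ (i, j))) \<le> max (Polynomials.degree p) 0" for p
      using poly_add_degree[of p "\<ominus>\<^bsub>poly_ring K\<^esub> poly_of_const (A $$ (i, j))"]
        univ_poly_a_inv_degree[OF carrier_is_subring c(1)] c(2)
      by (simp add: a_minus_def univ_poly_add)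
    from this[of "if i = j then X\<^bsub>K\<^esub> else \<zero>\<^bsub>poly_ring K\<^esub>"] show ?thesis
      using that X(2) by (auto simp: B_def univ_poly_zero split: if_splits)
  qed
  show "Polynomials.degree (char_poly_over K A) \<le> n"
    unfolding B by (rule degree_det_over_le[OF _ Bcar Bdeg]) (simp add: B_def)
  assume a: "a \<in> carrier K"
  interpret e: ring_hom_cring "poly_ring K" K "\<lambda>p. eval p a"
    by (rule eval_cring_hom[OF carrier_is_subring a])
  interpret h: ring_hom_cring K "class_ring :: 'f ring" h
    by (intro ring_hom_cring.intro ring_hom_cring_axioms.intro is_cring class_cring.is_cring h)
  define g where "g p = h (eval p a)" for p
  have g: "g \<in> Ring.ring_hom (poly_ring K) class_ring"
    by (rule ring_hom_memI) (auto simp: g_def)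
  have "map_mat g B = mat n n (\<lambda>(i, j). (if i = j then h a else 0) - h (A $$ (i, j)))"
  proof (rule eq_matI; simp add: B_def)
    fix i j assume ij: "i < n" "j < n"
    have c: "poly_of_const (A $$ (i, j)) \<in> carrier (poly_ring K)" "eval (poly_of_const (A $$ (i, j))) a = A $$ (i, j)"
      using const Acar[OF ij] a by blast+
    show "(i = j \<longrightarrow> g (X\<^bsub>K\<^esub> \<ominus>\<^bsub>poly_ring K\<^esub> poly_of_const (A $$ (j, j))) = h a - h (A $$ (j, j))) \<and>
      (i \<noteq> j \<longrightarrow> g (\<zero>\<^bsub>poly_ring K\<^esub> \<ominus>\<^bsub>poly_ring K\<^esub> poly_of_const (A $$ (i, j))) = - h (A $$ (i, j)))"
      using c X(1) Acar[OF ij] a eval_var[OF a]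
      by (auto simp: g_def a_minus_def class_ring_simps)
  qed
  then show "h (eval (char_poly_over K A) a) =
      det (mat n n (\<lambda>(i, j). (if i = j then h a else 0) - h (A $$ (i, j))))"
    using det_over_hom[OF P.is_cring g _ Bcar, of n] by (simp add: B g_def B_def)
qed

text \<open>
  The entries of an inverse of \<open>f - a\<close> lie in the ring \<open>K\<close> only, so invertibility is tested after
  applying a homomorphism \<open>h\<close> into a field that is a type.
\<close>

lemma reducible_char_poly_eigenvalue:
  fixes K :: "'r ring" and smul :: "'r \<Rightarrow> 'v::ab_group_add \<Rightarrow> 'v" and h :: "'r \<Rightarrow> 'f::field"
  assumes K: "field K" and V: "vectorspace K (additive_module smul V)"
    and h: "h \<in> Ring.ring_hom K class_ring"
    and rep: "represents K smul V f us A" and len: "length us \<le> 3"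
    and red: "reducible_poly K (char_poly_over K A)"
    and f_add: "\<And>x y. x \<in> V \<Longrightarrow> y \<in> V \<Longrightarrow> f (x + y) = f x + f y"
    and f_smul: "\<And>a x. a \<in> carrier K \<Longrightarrow> x \<in> V \<Longrightarrow> f (smul a x) = smul a (f x)"
  shows "\<exists>a\<in>carrier K. (\<lambda>x. f x - smul a x) ` V \<noteq> V"
proof -
  interpret field K by (fact K)
  define n where "n = length us"
  have us: "vectorspace.basis K (additive_module smul V) (set us)" "distinct us"
    and A: "A \<in> carrier_mat n n" "elements_mat A \<subseteq> carrier K"
    and fA: "\<And>j. j < n \<Longrightarrow> f (us ! j) = (\<Sum>i<n. smul (A $$ (i, j)) (us ! i))"
    using rep by (auto simp: represents_def n_def)
  have Acar: "A $$ (i, j) \<in> carrier K" if "i < n" "j < n" for i j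
    using elements_matI[OF A(1) that refl] A(2) by blast
  note cl = additive_module_closed[OF V] and sm = additive_module_smul[OF V]
  have us_in: "us ! i \<in> V" if "i < n" for i
    using basis_in[OF V us] that by (simp add: n_def)
  obtain a where a: "a \<in> carrier K" "eval (char_poly_over K A) a = \<zero>\<^bsub>K\<^esub>"
    using reducible_cubic_has_root[OF K red] char_poly_over_degree_and_eval(1)[OF K h A] len
    by (auto simp: n_def)
  interpret h: ring_hom_cring K "class_ring :: 'f ring" h
    by (intro ring_hom_cring.intro ring_hom_cring_axioms.intro is_cring class_cring.is_cring h)
  define G where "G = mat n n (\<lambda>(i, j). (if i = j then h a else 0) - h (A $$ (i, j)))"
  have detG: "det G = 0"
    using char_poly_over_degree_and_eval(2)[OF K h A a(1)] a(2) h.hom_zero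
    by (simp add: G_def class_ring_simps)
  show ?thesis
  proof (rule ccontr)
    assume "\<not> ?thesis"
    then have surj: "(\<lambda>x. f x - smul a x) ` V = V" using a(1) by blast
    \<comment> \<open>The numbers \<open>c\<close> are the coordinates of a preimage of
      \<open>us ! j\<close> under \<open>f - a\<close>. The matrix of \<open>f - a\<close> is the
      negative of the one in the characteristic polynomial, hence the \<open>- 1\<close> on the
      right.\<close>
    have "\<exists>c. (\<forall>i. c i \<in> carrier K) \<and> (\<forall>l<n.
        h a * h (c l) - (\<Sum>i<n. h (A $$ (l, i)) * h (c i)) = (if l = j then - 1 else 0))" if j: "j < n" for j
    proof -
      have "us ! j \<in> (\<lambda>x. f x - smul a x) ` V" using us_in[OF j] surj by simp
      then obtain x where x: "x \<in> V" "us ! j = f x - smul a x" by blast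
      obtain c where c: "\<And>i. c i \<in> carrier K" "x = (\<Sum>i<n. smul (c i) (us ! i))"
        using basis_spans[OF V us x(1)] unfolding n_def by metis
      \<comment> \<open>\<open>f\<close> is additive on \<open>V\<close> only, so the partial sums
        have to be kept inside \<open>V\<close> during an induction.\<close>
      have f_sum: "f (\<Sum>i\<in>I. smul (c i) (us ! i)) = (\<Sum>i\<in>I. smul (c i) (f (us ! i)))"
        if "I \<subseteq> {..<n}" for I
      proof -
        have "finite I" using that finite_subset by blast
        then show ?thesis using that
        proof (induction I)
          case empty
          have "f 0 = f 0 + f 0" using f_add[of 0 0] cl(1) by simp
          then show ?case by simp
        next
          case (insert i I)
          then have "smul (c i) (us ! i) \<in> V" "(\<Sum>i\<in>I. smul (c i) (us ! i)) \<in> V"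
            using us_in c(1) cl by (auto intro!: sum_closed[OF V])
          then show ?case using insert c(1) us_in by (simp add: f_add f_smul)
        qed
      qed
      have "f x = (\<Sum>i<n. smul (c i) (f (us ! i)))"
        unfolding c(2) by (rule f_sum) simp
      also have "\<dots> = (\<Sum>i<n. \<Sum>l<n. smul (c i) (smul (A $$ (l, i)) (us ! l)))"
        by (auto simp: fA intro!: sum.cong smul_sum[OF V] cl(3) Acar us_in c(1))
      also have "\<dots> = (\<Sum>l<n. \<Sum>i<n. smul (A $$ (l, i) \<otimes>\<^bsub>K\<^esub> c i) (us ! l))"
        using Acar us_in c(1) by (subst sum.swap) (simp add: sm(3)[symmetric] m_comm)
      also have "\<dots> = (\<Sum>l<n. smul (\<Oplus>\<^bsub>K\<^esub>i\<in>{..<n}. A $$ (l, i) \<otimes>\<^bsub>K\<^esub> c i) (us ! l))"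
        by (auto intro!: sum.cong finsum_smul[OF V, symmetric] m_closed Acar us_in c(1))
      finally have fx: "f x = (\<Sum>l<n. smul (\<Oplus>\<^bsub>K\<^esub>i\<in>{..<n}. A $$ (l, i) \<otimes>\<^bsub>K\<^esub> c i) (us ! l))" .
      have ax: "smul a x = (\<Sum>l<n. smul (a \<otimes>\<^bsub>K\<^esub> c l) (us ! l))"
        unfolding c(2) using a(1) c(1) us_in cl by (auto simp: sm(3) intro!: smul_sum[OF V])
      define d where "d l = (if l = j then \<one>\<^bsub>K\<^esub> else \<zero>\<^bsub>K\<^esub>)" for l
      have uj: "us ! j = (\<Sum>l<n. smul (d l) (us ! l))"
      proof -
        have "(\<Sum>l<n. smul (d l) (us ! l)) = (\<Sum>l<n. if l = j then us ! l else 0)"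
          using us_in by (intro sum.cong) (auto simp: d_def sm)
        then show ?thesis using j by simp
      qed
      define s where "s l = (\<Oplus>\<^bsub>K\<^esub>i\<in>{..<n}. A $$ (l, i) \<otimes>\<^bsub>K\<^esub> c i)" for l
      have s: "s l \<in> carrier K" if "l < n" for l
        using Acar[OF that] c(1) by (auto simp: s_def intro!: finsum_closed)
      have d: "d l \<in> carrier K" for l by (simp add: d_def)
      have minus: "smul (\<ominus>\<^bsub>K\<^esub> b) y = - smul b y" if "b \<in> carrier K" "y \<in> V" for b y
        using sm(2)[of b "\<ominus>\<^bsub>K\<^esub> b" y] that sm(5) by (simp add: r_neg add_eq_0_iff)
      have "0 = us ! j + smul a x - f x" using x(2) by simp
      also have "\<dots> = (\<Sum>l<n. smul (d l) (us ! l) + smul (a \<otimes>\<^bsub>K\<^esub> c l) (us ! l) - smul (s l) (us ! l))"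
        by (simp add: fx ax sum.distrib sum_subtractf s_def flip: uj)
      also have "\<dots> = (\<Sum>l<n. smul (d l \<oplus>\<^bsub>K\<^esub> (a \<otimes>\<^bsub>K\<^esub> c l) \<oplus>\<^bsub>K\<^esub> (\<ominus>\<^bsub>K\<^esub> s l)) (us ! l))"
        using s d a(1) c(1) us_in by (intro sum.cong) (simp_all add: sm(2) minus)
      finally have zero: "d l \<oplus>\<^bsub>K\<^esub> (a \<otimes>\<^bsub>K\<^esub> c l) \<oplus>\<^bsub>K\<^esub> (\<ominus>\<^bsub>K\<^esub> s l) = \<zero>\<^bsub>K\<^esub>" if "l < n" for l
        using basis_independent[OF V us, of "\<lambda>l. d l \<oplus>\<^bsub>K\<^esub> (a \<otimes>\<^bsub>K\<^esub> c l) \<oplus>\<^bsub>K\<^esub> (\<ominus>\<^bsub>K\<^esub> s l)" l]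
          that s d a(1) c(1) by (simp add: n_def)
      have "h a * h (c l) - (\<Sum>i<n. h (A $$ (l, i)) * h (c i)) = (if l = j then - 1 else 0)" if l: "l < n" for l
      proof -
        have hs: "h (s l) = (\<Sum>i<n. h (A $$ (l, i)) * h (c i))"
          unfolding s_def using Acar[OF l] c(1)
          by (subst h.hom_finsum) (auto simp: class_ring_simps intro!: sum.cong)
        have "h (d l) + h a * h (c l) + - h (s l) = 0"
          using arg_cong[OF zero[OF l], of h] s[OF l] d a(1) c(1)
          by (simp add: class_ring_simps)
        moreover have "h (d l) = (if l = j then 1 else 0)"
          using h.hom_one h.hom_zero by (simp add: d_def class_ring_simps)
        ultimately show ?thesis unfolding hs by (auto simp: algebra_simps add_eq_0_iff)
      qed
      then show ?thesis using c(1) by blast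
    qed
    then obtain c where c: "\<And>j l. j < n \<Longrightarrow> l < n \<Longrightarrow>
        h a * h (c j l) - (\<Sum>i<n. h (A $$ (l, i)) * h (c j i)) = (if l = j then - 1 else 0)"
      by metis
    \<comment> \<open>The negated coordinates of the preimages form the columns of a right inverse
      of \<open>G\<close>, which contradicts \<open>det G = 0\<close>.\<close>
    define H where "H = mat n n (\<lambda>(i, j). - h (c j i))"
    have "(G * H) $$ (i, j) = (if i = j then 1 else 0)" if ij: "i < n" "j < n" for i j
    proof -
      have "(G * H) $$ (i, j) =
        - (\<Sum>k<n. ((if i = k then h a else 0) - h (A $$ (i, k))) * h (c j k))"
        using ij by (simp add: G_def H_def scalar_prod_def sum_negf atLeast0LessThan)
      also have "(\<Sum>k<n. ((if i = k then h a else 0) - h (A $$ (i, k))) * h (c j k)) =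
        (\<Sum>k<n. (if i = k then h a * h (c j k) else 0)) - (\<Sum>k<n. h (A $$ (i, k)) * h (c j k))"
        unfolding sum_subtractf[symmetric] by (intro sum.cong) (auto simp: algebra_simps)
      also have "\<dots> = (if i = j then - 1 else 0)" using c[OF ij(2,1)] ij by simp
      finally show ?thesis by simp
    qed
    then have "G * H = 1\<^sub>m n" by (intro eq_matI) (simp_all add: G_def H_def)
    then have "det G * det H = 1"
      using det_mult[of G n H] by (simp add: G_def H_def)
    with detG show False by simp
  qed
qed

section \<open>Vector space instances and the use of semisimplicity\<close>

lemma additive_module_vectorspaceI:
  fixes K :: "'r ring" and smul :: "'r \<Rightarrow> 'v::ab_group_add \<Rightarrow> 'v"
  assumes K: "field K"
    and V: "0 \<in> V" "\<And>x y. x \<in> V \<Longrightarrow> y \<in> V \<Longrightarrow> x + y \<in> V" "\<And>x. x \<in> V \<Longrightarrow> - x \<in> V"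
      "\<And>a x. a \<in> carrier K \<Longrightarrow> x \<in> V \<Longrightarrow> smul a x \<in> V"
    and sm: "\<And>a x y. a \<in> carrier K \<Longrightarrow> x \<in> V \<Longrightarrow> y \<in> V \<Longrightarrow> smul a (x + y) = smul a x + smul a y"
      "\<And>a b x. a \<in> carrier K \<Longrightarrow> b \<in> carrier K \<Longrightarrow> x \<in> V \<Longrightarrow> smul (a \<oplus>\<^bsub>K\<^esub> b) x = smul a x + smul b x"
      "\<And>a b x. a \<in> carrier K \<Longrightarrow> b \<in> carrier K \<Longrightarrow> x \<in> V \<Longrightarrow> smul (a \<otimes>\<^bsub>K\<^esub> b) x = smul a (smul b x)"
      "\<And>x. x \<in> V \<Longrightarrow> smul \<one>\<^bsub>K\<^esub> x = x"
  shows "vectorspace K (additive_module smul V)"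
proof -
  interpret field K by (fact K)
  have "abelian_group (additive_module smul V)"
  proof (rule abelian_groupI)
    fix x assume "x \<in> carrier (additive_module smul V)"
    then have "- x \<in> carrier (additive_module smul V)" "- x \<oplus>\<^bsub>additive_module smul V\<^esub> x = \<zero>\<^bsub>additive_module smul V\<^esub>"
      using V by (auto simp: additive_module_def)
    then show "\<exists>y\<in>carrier (additive_module smul V). y \<oplus>\<^bsub>additive_module smul V\<^esub> x = \<zero>\<^bsub>additive_module smul V\<^esub>"
      by blast
  qed (use V in \<open>auto simp: additive_module_def algebra_simps\<close>)
  then have "Module.module K (additive_module smul V)"
    by (rule moduleI[OF is_cring]) (use V sm in \<open>auto simp: additive_module_def\<close>)
  then show ?thesis using K by (rule vectorspace.intro)
qed

lemma vector_space_additive_module: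
  fixes scale :: "'k::field \<Rightarrow> 'c::ab_group_add \<Rightarrow> 'c"
  assumes "vector_space scale"
    and V: "0 \<in> V" "\<And>x y. x \<in> V \<Longrightarrow> y \<in> V \<Longrightarrow> x + y \<in> V" "\<And>a x. x \<in> V \<Longrightarrow> scale a x \<in> V"
  shows "vectorspace class_ring (additive_module scale V)"
proof -
  interpret vector_space scale by fact
  show ?thesis
    by (rule additive_module_vectorspaceI[OF class_field])
      (use V V(3)[of _ "- 1"] in \<open>auto simp: scale_right_distrib scale_left_distrib\<close>)
qed

text \<open>
  Over the algebraic closure the coordinates with respect to an eigenbasis are functionals \<open>\<phi> i\<close> with
  \<open>\<phi> i (t x) = d i * \<phi> i x\<close>, so \<open>p(t)\<^sup>2 x = 0\<close> implies \<open>p(d i)\<^sup>2 \<phi> i x = 0\<close>.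
\<close>

lemma semisimple_endo_quadratic_kernel:
  fixes scale :: "'k::field \<Rightarrow> 'c::ab_group_add \<Rightarrow> 'c"
  assumes t: "Vector_Spaces.linear scale scale t" and ss: "semisimple_endo scale t"
  shows "let S = \<lambda>x. scale \<rho> (t (t x)) - scale \<tau> (t x) + scale \<nu> x in S (S x) = 0 \<longrightarrow> S x = 0"
proof -
  interpret t: Vector_Spaces.linear scale scale t by (fact t)
  obtain us A D where rep: "represents class_ring scale UNIV t us A"
    and sim: "similar_mat (map_mat to_ac A) D" and diag: "diagonal_mat D"
    using ss by (auto simp: semisimple_endo_def)
  define n where "n = length us"
  have us: "vectorspace.basis class_ring (additive_module scale UNIV) (set us)" "distinct us"
    and A: "A \<in> carrier_mat n n"
    and tA: "\<And>j. j < n \<Longrightarrow> t (us ! j) = (\<Sum>i<n. scale (A $$ (i, j)) (us ! i))"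
    using rep by (auto simp: represents_def n_def)
  have vs: "vectorspace class_ring (additive_module scale UNIV)"
    by (rule vector_space_additive_module) (auto intro: t.vs1.vector_space_axioms)
  obtain P Q where "similar_mat_wit (map_mat to_ac A) D P Q"
    using sim by (auto simp: similar_mat_def)
  then have car: "D \<in> carrier_mat n n" "P \<in> carrier_mat n n" "Q \<in> carrier_mat n n"
    and PQ: "P * Q = 1\<^sub>m n" "Q * P = 1\<^sub>m n" and APDQ: "map_mat to_ac A = P * D * Q"
    using A by (auto simp: similar_mat_wit_def Let_def)
  have "\<exists>c. x = (\<Sum>i<n. scale (c i) (us ! i))" for x
    using basis_spans[OF vs us, of x] by (auto simp: n_def)
  then obtain C where C: "\<And>x. x = (\<Sum>i<n. scale (C x i) (us ! i))" by metis
  have C_unique: "C x i = d i" if "x = (\<Sum>i<n. scale (d i) (us ! i))" "i < n" for x d i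
  proof -
    have "(\<Sum>i<n. scale (C x i - d i) (us ! i)) = 0"
      using C[of x] that(1) by (simp add: t.vs1.scale_left_diff_distrib sum_subtractf)
    then show ?thesis
      using basis_independent[OF vs us, of "\<lambda>i. C x i - d i" i] that(2) by (simp add: n_def)
  qed
  have C_add: "C (x + y) i = C x i + C y i" if "i < n" for x y i
    using C[of x] C[of y] that
    by (intro C_unique) (simp_all add: t.vs1.scale_left_distrib sum.distrib)
  have C_scale: "C (scale a x) i = a * C x i" if "i < n" for a x i
  proof (rule C_unique[OF _ that])
    have "scale a x = scale a (\<Sum>i<n. scale (C x i) (us ! i))" using C[of x] by simp
    then show "scale a x = (\<Sum>i<n. scale (a * C x i) (us ! i))" by (simp add: t.vs1.scale_sum_right)
  qed
  have C_t: "C (t x) i = (\<Sum>j<n. A $$ (i, j) * C x j)" if "i < n" for x i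
  proof (rule C_unique[OF _ that])
    have "t x = t (\<Sum>j<n. scale (C x j) (us ! j))" using C[of x] by simp
    also have "\<dots> = (\<Sum>j<n. \<Sum>i<n. scale (A $$ (i, j) * C x j) (us ! i))"
      by (simp add: t.sum t.scale tA t.vs1.scale_sum_right mult.commute)
    also have "\<dots> = (\<Sum>i<n. scale (\<Sum>j<n. A $$ (i, j) * C x j) (us ! i))"
      by (subst sum.swap) (simp add: t.vs1.scale_sum_left)
    finally show "t x = (\<Sum>i<n. scale (\<Sum>j<n. A $$ (i, j) * C x j) (us ! i))" .
  qed
  \<comment> \<open>\<open>\<phi> x\<close> is \<open>Q\<close> applied to the coordinate vector of
    \<open>x\<close>. From \<open>A = P D Q\<close> and \<open>Q P = 1\<close> follows
    \<open>Q A = D Q\<close>, so row \<open>i\<close> of \<open>Q\<close> is a left eigenvector of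
    \<open>A\<close> for \<open>D $$ (i, i)\<close>.\<close>
  define \<phi> where "\<phi> x i = (\<Sum>j<n. Q $$ (i, j) * to_ac (C x j))" for x i
  have \<phi>_add: "\<phi> (x + y) i = \<phi> x i + \<phi> y i" for x y i
    by (simp add: \<phi>_def C_add sum.distrib distrib_left)
  have \<phi>_scale: "\<phi> (scale a x) i = to_ac a * \<phi> x i" for a x i
    by (simp add: \<phi>_def C_scale sum_distrib_left mult.left_commute)
  have \<phi>_diff: "\<phi> (x - y) i = \<phi> x i - \<phi> y i" for x y i
    using \<phi>_add[of "x - y" y i] by simp
  have QA: "(\<Sum>j<n. Q $$ (i, j) * to_ac (A $$ (j, m))) = D $$ (i, i) * Q $$ (i, m)"
    if "i < n" "m < n" for i m
  proof -
    have "Q * map_mat to_ac A = (Q * P) * (D * Q)"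
      unfolding APDQ using car by (simp add: assoc_mult_mat[of _ n n _ n _ n])
    then have "Q * map_mat to_ac A = D * Q" using car PQ by simp
    then have "(Q * map_mat to_ac A) $$ (i, m) = (D * Q) $$ (i, m)" by simp
    moreover have "(D * Q) $$ (i, m) = (\<Sum>j = 0..<n. if j = i then D $$ (i, i) * Q $$ (i, m) else 0)"
    proof -
      have "D $$ (i, j) = 0" if "j < n" "j \<noteq> i" for j
        using diag car that \<open>i < n\<close> by (auto simp: diagonal_mat_def)
      then have "(\<Sum>j = 0..<n. D $$ (i, j) * Q $$ (j, m)) =
        (\<Sum>j = 0..<n. if j = i then D $$ (i, i) * Q $$ (i, m) else 0)"
        by (intro sum.cong) auto
      then show ?thesis using that car by (simp add: scalar_prod_def)
    qed
    ultimately show ?thesis using that car A by (simp add: scalar_prod_def atLeast0LessThan)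
  qed
  have \<phi>_t: "\<phi> (t x) i = D $$ (i, i) * \<phi> x i" if "i < n" for x i
  proof -
    have "\<phi> (t x) i = (\<Sum>j<n. \<Sum>m<n. Q $$ (i, j) * to_ac (A $$ (j, m)) * to_ac (C x m))"
      by (simp add: \<phi>_def C_t to_ac_sum sum_distrib_left mult.assoc)
    also have "\<dots> = (\<Sum>m<n. (\<Sum>j<n. Q $$ (i, j) * to_ac (A $$ (j, m))) * to_ac (C x m))"
      by (subst sum.swap) (simp add: sum_distrib_right)
    also have "\<dots> = D $$ (i, i) * \<phi> x i"
      using that by (simp add: QA \<phi>_def sum_distrib_left mult.assoc)
    finally show ?thesis .
  qed
  \<comment> \<open>The functionals separate points: \<open>P Q = 1\<close> recovers the coordinates
    of \<open>x\<close> from the values \<open>\<phi> x i\<close>.\<close>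
  have \<phi>_zero: "x = 0" if z: "\<And>i. i < n \<Longrightarrow> \<phi> x i = 0" for x
  proof -
    have "C x m = 0" if m: "m < n" for m
    proof -
      have PQ': "(\<Sum>i<n. P $$ (m, i) * Q $$ (i, j)) = (if m = j then 1 else 0)" if "j < n" for j
      proof -
        have "(P * Q) $$ (m, j) = (\<Sum>i<n. P $$ (m, i) * Q $$ (i, j))"
          using car m that by (simp add: scalar_prod_def atLeast0LessThan)
        then show ?thesis using PQ(1) m that by simp
      qed
      have "0 = (\<Sum>i<n. P $$ (m, i) * \<phi> x i)" using z by simp
      also have "\<dots> = (\<Sum>i<n. \<Sum>j<n. P $$ (m, i) * Q $$ (i, j) * to_ac (C x j))"
        by (simp add: \<phi>_def sum_distrib_left mult.assoc)
      also have "\<dots> = (\<Sum>j<n. (\<Sum>i<n. P $$ (m, i) * Q $$ (i, j)) * to_ac (C x j))"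
        by (subst sum.swap) (simp add: sum_distrib_right)
      also have "\<dots> = (\<Sum>j<n. if m = j then to_ac (C x j) else 0)"
        using PQ' by (intro sum.cong) auto
      also have "\<dots> = to_ac (C x m)" using m by simp
      finally show ?thesis by simp
    qed
    then show "x = 0" using C[of x] by simp
  qed
  define S where "S x = scale \<rho> (t (t x)) - scale \<tau> (t x) + scale \<nu> x" for x
  define s where "s i = to_ac \<rho> * (D $$ (i, i))\<^sup>2 - to_ac \<tau> * D $$ (i, i) + to_ac \<nu>" for i
  have \<phi>_S: "\<phi> (S x) i = s i * \<phi> x i" if "i < n" for x i
    using that by (simp add: S_def s_def \<phi>_add \<phi>_diff \<phi>_scale \<phi>_t power2_eq_square algebra_simps)
  have "S x = 0" if "S (S x) = 0"
  proof (rule \<phi>_zero)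
    fix i assume i: "i < n"
    have "\<phi> 0 i = 0" using \<phi>_scale[of 0 0 i] by simp
    then have "s i * (s i * \<phi> x i) = 0" using \<phi>_S[OF i, of "S x"] \<phi>_S[OF i, of x] that by simp
    then show "\<phi> (S x) i = 0" using \<phi>_S[OF i, of x] by auto
  qed
  then show ?thesis by (simp add: S_def Let_def)
qed

section \<open>Binary quadratic forms\<close>

text \<open>
  The two sides are the norms of trace-zero elements of the quaternion algebra with norm form
  \<open>\<langle>1, \<alpha>, \<beta>, \<alpha> \<beta>\<rangle>\<close>: the first one is orthogonal to a prescribed vector, the second one to the
  quadratic subalgebra. The two orthogonal complements meet in a line of the three-dimensional space
  of trace-zero elements. If this line is isotropic, then \<open>\<langle>\<beta>, \<alpha> \<beta>\<rangle>\<close> is a hyperbolic plane and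
  represents everything.
\<close>

lemma common_value_of_binary_forms:
  fixes \<alpha> \<beta> D1 D2 D3 :: "'k::field"
  assumes \<alpha>: "\<alpha> \<noteq> 0" and \<beta>: "\<beta> \<noteq> 0" and two: "(2::'k) \<noteq> 0"
  shows "\<exists>z s r s' r'. \<alpha> * z * D1 + \<beta> * (s * D2 + \<alpha> * r * D3) = 0 \<and>
    \<alpha> * z\<^sup>2 + \<beta> * (s\<^sup>2 + \<alpha> * r\<^sup>2) = \<beta> * (s'\<^sup>2 + \<alpha> * r'\<^sup>2) \<and> \<beta> * (s'\<^sup>2 + \<alpha> * r'\<^sup>2) \<noteq> 0"
proof (cases "D2 = 0 \<and> D3 = 0")
  case True
  \<comment> \<open>Here the prescribed vector has no component in the plane
    \<open>\<langle>\<beta>, \<alpha> \<beta>\<rangle>\<close>, so the same vector of norm \<beta>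
    serves on both sides.\<close>
  have "\<alpha> * 0 * D1 + \<beta> * (1 * D2 + \<alpha> * 0 * D3) = 0 \<and>
    \<alpha> * 0\<^sup>2 + \<beta> * (1\<^sup>2 + \<alpha> * 0\<^sup>2) = \<beta> * (1\<^sup>2 + \<alpha> * 0\<^sup>2) \<and> \<beta> * (1\<^sup>2 + \<alpha> * 0\<^sup>2) \<noteq> 0"
    using True \<beta> by simp
  then show ?thesis by blast
next
  case nz: False
  show ?thesis
  proof (cases "\<alpha> * D3\<^sup>2 + D2\<^sup>2 = 0")
    case False
    \<comment> \<open>With \<open>z = 0\<close> the linear condition is solved by
      \<open>(s, r) = (\<alpha> D3, - D2)\<close>. This vector lies in both spaces and is used on
      both sides; its norm is nonzero in this case.\<close>
    have "\<alpha> * 0 * D1 + \<beta> * ((\<alpha> * D3) * D2 + \<alpha> * (- D2) * D3) = 0"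
      by simp
    moreover have "(\<alpha> * D3)\<^sup>2 + \<alpha> * (- D2)\<^sup>2 = \<alpha> * (\<alpha> * D3\<^sup>2 + D2\<^sup>2)"
      by (simp add: power2_eq_square algebra_simps)
    then have "\<beta> * ((\<alpha> * D3)\<^sup>2 + \<alpha> * (- D2)\<^sup>2) \<noteq> 0" using False \<alpha> \<beta> by simp
    moreover have "\<alpha> * 0\<^sup>2 + \<beta> * ((\<alpha> * D3)\<^sup>2 + \<alpha> * (- D2)\<^sup>2) = \<beta> * ((\<alpha> * D3)\<^sup>2 + \<alpha> * (- D2)\<^sup>2)"
      by simp
    ultimately show ?thesis by blast
  next
    case True
    have D3: "D3 \<noteq> 0" using True nz by auto
    define m where "m = D2 / D3"
    have D2: "D2 = m * D3" using D3 by (simp add: m_def)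
    have "(\<alpha> + m\<^sup>2) * D3\<^sup>2 = 0" using True by (simp add: D2 power_mult_distrib algebra_simps)
    then have "\<alpha> + m\<^sup>2 = 0" using D3 by simp
    then have a: "\<alpha> = - m\<^sup>2" by (rule eq_neg_iff_add_eq_0[THEN iffD2])
    have m: "m \<noteq> 0" using a \<alpha> by auto
    \<comment> \<open>Since \<alpha> is now minus the square of \<open>m\<close>, the form in
      \<open>(s, r)\<close> factors as \<open>(s - m r) (s + m r)\<close>. Taking
      \<open>s = S / 2\<close> and \<open>r = - S / (2 m)\<close> kills the second factor, so only
      \<open>z = 1\<close> contributes to the norm, and \<open>S\<close> is what the linear
      condition then demands. The common value is \<alpha>.\<close>
    define S where "S = m * D1 / (\<beta> * D3)"
    have "\<alpha> * 1 * D1 + \<beta> * (S / 2 * D2 + \<alpha> * (- S / (2 * m)) * D3) = 0"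
    proof -
      have "S / 2 * D2 + \<alpha> * (- S / (2 * m)) * D3 = S * m * D3"
        using m two by (simp add: D2 a field_simps power2_eq_square)
      then show ?thesis using D3 \<beta> by (simp add: S_def a power2_eq_square)
    qed
    moreover have "\<alpha> * 1\<^sup>2 + \<beta> * ((S / 2)\<^sup>2 + \<alpha> * (- S / (2 * m))\<^sup>2) = \<alpha>"
      using m two by (simp add: a field_simps power2_eq_square)
    \<comment> \<open>To represent \<alpha> by the hyperbolic plane, \<open>s'\<close> and
      \<open>r'\<close> are chosen so that \<open>s' - m r' = 1\<close> and
      \<open>s' + m r' = \<alpha> / \<beta>\<close>.\<close>
    moreover have "\<beta> * (((1 + \<alpha> / \<beta>) / 2)\<^sup>2 + \<alpha> * ((\<alpha> / \<beta> - 1) / (2 * m))\<^sup>2) = \<alpha>"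
    proof -
      have "\<alpha> * ((\<alpha> / \<beta> - 1) / (2 * m))\<^sup>2 = - ((\<alpha> / \<beta> - 1) / 2)\<^sup>2"
        using m two by (simp add: a power_divide power_mult_distrib)
      then have "((1 + \<alpha> / \<beta>) / 2)\<^sup>2 + \<alpha> * ((\<alpha> / \<beta> - 1) / (2 * m))\<^sup>2 =
          ((1 + \<alpha> / \<beta>) / 2)\<^sup>2 - ((\<alpha> / \<beta> - 1) / 2)\<^sup>2"
        by simp
      also have "\<dots> = ((1 + \<alpha> / \<beta>) / 2 - (\<alpha> / \<beta> - 1) / 2) * ((1 + \<alpha> / \<beta>) / 2 + (\<alpha> / \<beta> - 1) / 2)"
        by (simp add: power2_eq_square algebra_simps)
      also have "(1 + \<alpha> / \<beta>) / 2 - (\<alpha> / \<beta> - 1) / 2 = 1"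
        using two by (simp add: diff_divide_distrib[symmetric])
      also have "(1 + \<alpha> / \<beta>) / 2 + (\<alpha> / \<beta> - 1) / 2 = \<alpha> / \<beta>"
        using two by (simp add: add_divide_distrib[symmetric])
      finally show ?thesis using \<beta> by simp
    qed
    ultimately show ?thesis using \<alpha> by metis
  qed
qed

section \<open>Composition algebra identities\<close>

locale octonion_algebra_char_not_2 = octonion_algebra scale mul e1 N
  for scale :: "'k::field \<Rightarrow> 'c::ab_group_add \<Rightarrow> 'c" (infixr "*\<^sub>k" 75)
    and mul :: "'c \<Rightarrow> 'c \<Rightarrow> 'c" (infixl "\<star>" 70)
    and e1 :: 'c
    and N :: "'c \<Rightarrow> 'k" +
  assumes two_neq_zero: "(2::'k) \<noteq> 0"
begin

lemma mul_add_right: "x \<star> (y + z) = x \<star> y + x \<star> z"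
  and mul_scale_right [simp]: "x \<star> (c *\<^sub>k y) = c *\<^sub>k (x \<star> y)"
  using linear_mul_left[of x] by (simp_all add: Vector_Spaces.linear_iff)

lemma mul_add_left: "(y + z) \<star> x = y \<star> x + z \<star> x"
  and mul_scale_left [simp]: "(c *\<^sub>k y) \<star> x = c *\<^sub>k (y \<star> x)"
  using linear_mul_right[of x] by (simp_all add: Vector_Spaces.linear_iff)

lemma mul_zero_right [simp]: "x \<star> 0 = 0"
  using mul_scale_right[of x 0 0] by simp

lemma mul_zero_left [simp]: "0 \<star> x = 0"
  using mul_scale_left[of 0 0 x] by simp

lemma mul_minus_right [simp]: "x \<star> (- y) = - (x \<star> y)"
  using mul_scale_right[of x "-1" y] by simp

lemma mul_minus_left [simp]: "(- y) \<star> x = - (y \<star> x)"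
  using mul_scale_left[of "-1" y x] by simp

lemma mul_diff_right: "x \<star> (y - z) = x \<star> y - x \<star> z"
  using mul_add_right[of x y "- z"] by simp

lemma mul_diff_left: "(y - z) \<star> x = y \<star> x - z \<star> x"
  using mul_add_left[of y "- z" x] by simp

lemmas mul_distribs = mul_add_left mul_add_right mul_diff_left mul_diff_right

declare unit_left [simp] unit_right [simp]

lemma polar_commute: "polar x y = polar y x"
  by (simp add: polar_def add.commute)

lemma polar_add_right: "polar x (y + z) = polar x y + polar x z"
  and polar_scale_right [simp]: "polar x (c *\<^sub>k y) = c * polar x y"
  using N_polar_linear[of x] by (simp_all add: Vector_Spaces.linear_iff polar_def)

lemma polar_add_left: "polar (y + z) x = polar y x + polar z x"
  and polar_scale_left [simp]: "polar (c *\<^sub>k y) x = c * polar y x"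
  by (simp_all add: polar_commute[of _ x] polar_add_right)

lemma polar_zero_right [simp]: "polar x 0 = 0"
  using polar_scale_right[of x 0 0] by simp

lemma polar_zero_left [simp]: "polar 0 x = 0"
  using polar_scale_left[of 0 0 x] by simp

lemma polar_minus_right [simp]: "polar x (- y) = - polar x y"
  using polar_scale_right[of x "-1" y] by simp

lemma polar_minus_left [simp]: "polar (- y) x = - polar y x"
  using polar_scale_left[of "-1" y x] by simp

lemma polar_diff_right: "polar x (y - z) = polar x y - polar x z"
  using polar_add_right[of x y "- z"] by simp

lemma polar_diff_left: "polar (y - z) x = polar y x - polar z x"
  using polar_add_left[of y "- z" x] by simp

lemmas polar_distribs = polar_add_left polar_add_right polar_diff_left polar_diff_right

lemma linear_polar: "Vector_Spaces.linear scale (*) (polar x)"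
  using N_polar_linear[of x] by (simp add: polar_def[abs_def])

lemma polar_nondegenerate: "(\<And>y. polar x y = 0) \<Longrightarrow> x = 0"
  using N_nondegenerate[of x] by (simp add: polar_def)

lemma polar_eqI:
  assumes "\<And>z. polar x z = polar y z"
  shows "x = y"
  using polar_nondegenerate[of "x - y"] assms by (simp add: polar_diff_left)

lemma N_add: "N (x + y) = N x + N y + polar x y"
  by (simp add: polar_def)

lemma N_zero [simp]: "N 0 = 0"
  using N_scale[of 0 0] by simp

lemma N_minus [simp]: "N (- x) = N x"
  using N_scale[of "-1" x] by simp

lemma N_diff: "N (x - y) = N x + N y - polar x y"
  using N_add[of x "- y"] by simp

lemma polar_self: "polar x x = 2 * N x"
proof -
  have "N (x + x) = 4 * N x"
    using N_scale[of 2 x] scale_left_distrib[of 1 1 x] by (simp add: power2_eq_square)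
  then show ?thesis by (simp add: polar_def)
qed

lemma e1_nonzero: "e1 \<noteq> 0"
proof
  assume "e1 = 0"
  then have "x = 0" for x :: 'c using unit_left[of x] by simp
  then have "(UNIV :: 'c set) = span {}" by (auto simp: span_empty)
  then have "dim UNIV \<le> card ({} :: 'c set)"
    by (intro dim_le_card) auto
  then show False using dim_8 by simp
qed

lemma N_e1 [simp]: "N e1 = 1"
proof -
  have "N e1 \<noteq> 0"
  proof
    assume "N e1 = 0"
    then have "N x = 0" for x using N_mult[of e1 x] by simp
    then have "e1 = 0" by (intro polar_nondegenerate) (simp add: polar_def)
    with e1_nonzero show False by simp
  qed
  moreover have "N e1 = N e1 * N e1" using N_mult[of e1 e1] by simp
  ultimately show ?thesis by simp
qed

lemma polar_mul_left_cancel: "polar (x \<star> y) (x \<star> z) = N x * polar y z"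
  using N_mult[of x "y + z"]
  by (simp add: mul_add_right N_add N_mult algebra_simps)

lemma polar_mul_right_cancel: "polar (y \<star> x) (z \<star> x) = polar y z * N x"
  using N_mult[of "y + z" x]
  by (simp add: mul_add_left N_add N_mult algebra_simps)

text \<open>Multiplicativity of the norm polarized in both arguments. The adjointness and
  alternativity identities below all go back to it, and so does associativity of a subalgebra that
  can be doubled.\<close>

lemma polar_exchange: "polar (x \<star> y) (z \<star> w) + polar (x \<star> w) (z \<star> y) = polar x z * polar y w"
proof -
  have "polar ((x + z) \<star> y) ((x + z) \<star> w) = (N x + N z + polar x z) * polar y w"
    by (simp add: polar_mul_left_cancel N_add)
  then show ?thesis
    by (simp add: mul_add_left polar_distribs polar_mul_left_cancel polar_commute[of "z \<star> y"]
        algebra_simps)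
qed

definition tr :: "'c \<Rightarrow> 'k" where
  "tr x = polar x e1"

definition conj :: "'c \<Rightarrow> 'c" where
  "conj x = tr x *\<^sub>k e1 - x"

lemma tr_add: "tr (x + y) = tr x + tr y"
  and tr_diff: "tr (x - y) = tr x - tr y"
  and tr_scale [simp]: "tr (c *\<^sub>k x) = c * tr x"
  and tr_minus [simp]: "tr (- x) = - tr x"
  and tr_zero [simp]: "tr 0 = 0"
  and tr_e1 [simp]: "tr e1 = 2"
  by (simp_all add: tr_def polar_distribs polar_self)

lemma conj_add: "conj (x + y) = conj x + conj y"
  and conj_diff: "conj (x - y) = conj x - conj y"
  and conj_scale [simp]: "conj (c *\<^sub>k x) = c *\<^sub>k conj x"
  and conj_minus [simp]: "conj (- x) = - conj x"
  and conj_zero [simp]: "conj 0 = 0"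
  and conj_e1 [simp]: "conj e1 = e1"
      apply (simp_all add: conj_def tr_add tr_diff scale_left_distrib scale_right_diff_distrib
      scale_left_diff_distrib)
  using scale_left_distrib[of 1 1 e1] by simp

lemma tr_conj [simp]: "tr (conj x) = tr x"
  by (simp add: conj_def tr_diff)

lemma conj_conj [simp]: "conj (conj x) = x"
  by (simp add: conj_def[of "conj x"]) (simp add: conj_def)

lemma conj_pure: "tr x = 0 \<Longrightarrow> conj x = - x"
  by (simp add: conj_def)

lemma polar_conj_left: "polar (conj x) y = polar x (conj y)"
  by (simp add: conj_def polar_distribs tr_def polar_commute)

lemma N_conj [simp]: "N (conj x) = N x"
  by (simp add: conj_def N_diff N_scale power2_eq_square tr_def polar_commute[of e1])

text \<open>The exchange identity with \<open>e1\<close> in third place; the trace term on its right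
  side is what turns \<open>x\<close> into \<open>conj x\<close>.\<close>

lemma polar_adjoint_left: "polar (x \<star> y) z = polar y (conj x \<star> z)"
  using polar_exchange[of x y e1 z]
  by (simp add: conj_def mul_diff_left polar_distribs tr_def polar_commute algebra_simps)

lemma polar_adjoint_right: "polar (y \<star> x) z = polar y (z \<star> conj x)"
  using polar_exchange[of y x z e1]
  by (simp add: conj_def mul_diff_right polar_distribs tr_def polar_commute algebra_simps)

text \<open>The linearized alternative law, obtained by pairing with an arbitrary \<open>w\<close>.
  For orthogonal \<open>x\<close> and \<open>z\<close> it exchanges the two left factors, which
  replaces associativity in later computations.\<close>

lemma conj_mul_mul: "conj x \<star> (z \<star> y) + conj z \<star> (x \<star> y) = polar x z *\<^sub>k y"
proof (rule polar_eqI)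
  fix w
  have "polar (conj x \<star> (z \<star> y)) w = polar (z \<star> y) (x \<star> w)"
    "polar (conj z \<star> (x \<star> y)) w = polar (x \<star> y) (z \<star> w)"
    by (simp_all add: polar_adjoint_left[of "conj _"])
  then show "polar (conj x \<star> (z \<star> y) + conj z \<star> (x \<star> y)) w = polar (polar x z *\<^sub>k y) w"
    using polar_exchange[of x y z w]
    by (simp add: polar_add_left polar_commute[of "z \<star> y" "x \<star> w"] add.commute)
qed

lemma mul_mul_conj: "(z \<star> x) \<star> conj y + (z \<star> y) \<star> conj x = polar x y *\<^sub>k z"
proof (rule polar_eqI)
  fix w
  have "polar ((z \<star> x) \<star> conj y) w = polar (z \<star> x) (w \<star> y)"
    "polar ((z \<star> y) \<star> conj x) w = polar (z \<star> y) (w \<star> x)"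
    by (simp_all add: polar_adjoint_right[of _ "conj _"])
  then show "polar ((z \<star> x) \<star> conj y + (z \<star> y) \<star> conj x) w = polar (polar x y *\<^sub>k z) w"
    using polar_exchange[of z x w y] by (simp add: polar_add_left mult.commute)
qed

lemma half_scale: "x + x = (2 * c) *\<^sub>k y \<Longrightarrow> x = c *\<^sub>k y"
proof -
  assume "x + x = (2 * c) *\<^sub>k y"
  then have "2 *\<^sub>k x = 2 *\<^sub>k (c *\<^sub>k y)"
    using scale_left_distrib[of 1 1 x] by simp
  then show ?thesis using two_neq_zero by (simp del: scale_scale)
qed

lemma conj_mul_cancel: "conj x \<star> (x \<star> y) = N x *\<^sub>k y"
  using conj_mul_mul[of x x y] half_scale[of "conj x \<star> (x \<star> y)" "N x" y] by (simp add: polar_self)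

lemma mul_conj_cancel: "x \<star> (conj x \<star> y) = N x *\<^sub>k y"
  using conj_mul_cancel[of "conj x" y] by simp

lemma mul_cancel_conj: "(y \<star> x) \<star> conj x = N x *\<^sub>k y"
  using mul_mul_conj[of y x x] half_scale[of "(y \<star> x) \<star> conj x" "N x" y] by (simp add: polar_self)

lemma mul_cancel_conj': "(y \<star> conj x) \<star> x = N x *\<^sub>k y"
  using mul_cancel_conj[of y "conj x"] by simp

lemma mul_conj_self: "x \<star> conj x = N x *\<^sub>k e1"
  using mul_cancel_conj[of e1 x] by simp

lemma conj_mul_self: "conj x \<star> x = N x *\<^sub>k e1"
  using conj_mul_cancel[of x e1] by simp

lemma conj_mul: "conj (x \<star> y) = conj y \<star> conj x"
proof (rule polar_eqI)
  fix z
  have "polar (conj (x \<star> y)) z = polar (x \<star> y) (conj z)" by (rule polar_conj_left)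
  also have "\<dots> = polar y (conj x \<star> conj z)" by (rule polar_adjoint_left)
  also have "\<dots> = polar (y \<star> z) (conj x)" by (simp add: polar_adjoint_right)
  also have "\<dots> = polar (conj y \<star> conj x) z"
    using polar_adjoint_left[of "conj y" "conj x" z] by (simp add: polar_commute[of "conj x"])
  finally show "polar (conj (x \<star> y)) z = polar (conj y \<star> conj x) z" .
qed

lemma pure_square: "tr x = 0 \<Longrightarrow> x \<star> (x \<star> y) = - (N x *\<^sub>k y)"
  using conj_mul_cancel[of x y] by (simp add: conj_pure minus_equation_iff)

section \<open>Subalgebras and doubling\<close>

definition unital_subalgebra :: "'c set \<Rightarrow> bool" where
  "unital_subalgebra B \<longleftrightarrow> subspace B \<and> e1 \<in> B \<and> (\<forall>x\<in>B. \<forall>y\<in>B. x \<star> y \<in> B)"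

definition nondegenerate_on :: "'c set \<Rightarrow> bool" where
  "nondegenerate_on B \<longleftrightarrow> (\<forall>x\<in>B. (\<forall>y\<in>B. polar x y = 0) \<longrightarrow> x = 0)"

lemma subalgebraD:
  assumes "unital_subalgebra B"
  shows "subspace B" "e1 \<in> B" "0 \<in> B"
    and "x \<in> B \<Longrightarrow> y \<in> B \<Longrightarrow> x \<star> y \<in> B"
    and "x \<in> B \<Longrightarrow> y \<in> B \<Longrightarrow> x + y \<in> B"
    and "x \<in> B \<Longrightarrow> y \<in> B \<Longrightarrow> x - y \<in> B"
    and "x \<in> B \<Longrightarrow> c *\<^sub>k x \<in> B"
    and "x \<in> B \<Longrightarrow> - x \<in> B"
    and "x \<in> B \<Longrightarrow> conj x \<in> B"
  using assms unfolding unital_subalgebra_def conj_def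
  by (auto intro: subspace_add subspace_diff subspace_scale subspace_neg subspace_0)

lemma orth_iff: "w \<in> orth B \<longleftrightarrow> (\<forall>x\<in>B. polar w x = 0)"
  by (simp add: orth_def)

lemma subspace_orth: "subspace (orth B)"
  by (auto simp: subspace_def orth_def polar_add_left)

context
  fixes B w
  assumes B: "unital_subalgebra B" and w: "w \<in> orth B"
begin

lemma orth_tr: "tr w = 0"
  using w subalgebraD(2)[OF B] by (simp add: orth_def tr_def)

lemma orth_conj: "conj w = - w"
  by (simp add: conj_pure orth_tr)

lemma orth_polar: "x \<in> B \<Longrightarrow> polar w x = 0" "x \<in> B \<Longrightarrow> polar x w = 0"
  using w by (simp_all add: orth_def polar_commute[of _ w])

lemma orth_mul: "x \<in> B \<Longrightarrow> x \<star> w \<in> orth B"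
  by (auto simp: orth_iff polar_adjoint_left orth_polar subalgebraD[OF B])

text \<open>\<open>x \<star> w\<close> is again orthogonal to \<open>e1\<close>, so conjugation
  negates it, and conjugation also reverses the product.\<close>

lemma orth_swap: "x \<in> B \<Longrightarrow> x \<star> w = w \<star> conj x"
proof -
  assume x: "x \<in> B"
  have "tr (x \<star> w) = 0"
    using orth_mul[OF x] subalgebraD(2)[OF B] by (simp add: orth_def tr_def)
  then have "x \<star> w = - conj (x \<star> w)" by (simp add: conj_pure)
  also have "\<dots> = w \<star> conj x" by (simp add: conj_mul orth_conj)
  finally show ?thesis .
qed

text \<open>First of the Cayley-Dickson rules. After writing \<open>y \<star> w\<close> as
  \<open>w \<star> conj y\<close>, the factors \<open>x\<close> and \<open>w\<close> can be
  exchanged since \<open>conj x\<close> is orthogonal to \<open>w\<close>; the reversed order of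
  \<open>x\<close> and \<open>y\<close> is the cost of moving \<open>w\<close> back to the
  right.\<close>

lemma double_left: "x \<in> B \<Longrightarrow> y \<in> B \<Longrightarrow> x \<star> (y \<star> w) = (y \<star> x) \<star> w"
proof -
  assume x: "x \<in> B" and y: "y \<in> B"
  have "x \<star> (w \<star> conj y) = w \<star> (conj x \<star> conj y)"
    using conj_mul_mul[of "conj x" w "conj y"] orth_polar subalgebraD(9)[OF B x] by (simp add: orth_conj)
  also have "\<dots> = (y \<star> x) \<star> w"
    using orth_swap[of "y \<star> x"] subalgebraD[OF B] x y by (simp add: conj_mul)
  finally show ?thesis using orth_swap[OF y] by simp
qed

lemma double_double: "x \<in> B \<Longrightarrow> y \<in> B \<Longrightarrow> (x \<star> w) \<star> (y \<star> w) = - (N w *\<^sub>k (conj y \<star> x))"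
proof -
  assume x: "x \<in> B" and y: "y \<in> B"
  have "(x \<star> w) \<star> (y \<star> w) = (x \<star> (y \<star> w)) \<star> conj w - polar w (y \<star> w) *\<^sub>k x"
  proof -
    have "conj (y \<star> w) = - (y \<star> w)"
      using orth_mul[OF y] subalgebraD(2)[OF B] by (intro conj_pure) (simp add: orth_def tr_def)
    then show ?thesis using mul_mul_conj[of x w "y \<star> w"] by (simp add: algebra_simps)
  qed
  also have "(x \<star> (y \<star> w)) \<star> conj w = N w *\<^sub>k (y \<star> x)"
    using x y by (simp add: double_left mul_cancel_conj)
  also have "polar w (y \<star> w) = tr y * N w"
    using polar_mul_right_cancel[of e1 w y] by (simp add: tr_def polar_commute)
  finally show ?thesis
    by (simp add: conj_def mul_diff_left scale_right_diff_distrib mult.commute)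
qed

end

lemma double_right:
  assumes "unital_subalgebra B" "w \<in> orth B" "x \<in> B" "y \<in> B"
  shows "(y \<star> w) \<star> x = (y \<star> conj x) \<star> w"
  using orth_swap[OF assms(1) orth_mul[OF assms(1,2,4)], of "conj x"]
    double_left[OF assms(1,2), of "conj x" y] subalgebraD[OF assms(1)] assms(3,4)
  by simp

section \<open>Finite dimension and orthogonal complements\<close>

definition std_basis :: "'c set" where
  "std_basis = (SOME B. finite B \<and> independent B \<and> span B = UNIV)"

text \<open>The finite-dimensional locale takes a basis as a parameter, whereas only
  \<open>dim\<close> is given; any finite basis will do.\<close>

sublocale fd: finite_dimensional_vector_space scale std_basis
proof -
  obtain B :: "'c set" where "B \<subseteq> UNIV" "independent B" "UNIV \<subseteq> span B" "card B = dim UNIV"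
    by (rule basis_exists)
  \<comment> \<open>An infinite set has cardinality 0, so dimension 8 forces finiteness.\<close>
  moreover from this have "finite B" using dim_8 card_ge_0_finite[of B] by simp
  ultimately have "finite B \<and> independent B \<and> span B = UNIV" by blast
  then have "finite std_basis \<and> independent std_basis \<and> span std_basis = UNIV"
    unfolding std_basis_def by (rule someI[of _ B])
  then show "finite_dimensional_vector_space scale std_basis"
    by unfold_locales auto
qed

lemma linearI:
  assumes "\<And>x y. f (x + y) = f x + f y" "\<And>c x. f (c *\<^sub>k x) = c *\<^sub>k f x"
  shows "Vector_Spaces.linear scale scale f"
  using assms vector_space_axioms by (simp add: Vector_Spaces.linear_iff)

text \<open>Preservation of dimension under injective maps. Read contrapositively, it is how failure
  of surjectivity of \<open>t - a\<close> becomes an eigenvector.\<close>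

lemma linear_on_subspace_surj:
  assumes f: "Vector_Spaces.linear scale scale f" and S: "subspace S"
    and into: "f ` S \<subseteq> S" and ker: "\<And>x. x \<in> S \<Longrightarrow> f x = 0 \<Longrightarrow> x = 0"
  shows "f ` S = S"
proof -
  interpret f: Vector_Spaces.linear scale scale f by (fact f)
  interpret P: finite_dimensional_vector_space_pair_1 scale std_basis scale ..
  have "inj_on f (span S)"
    unfolding span_eq_iff[THEN iffD2, OF S]
  proof (rule inj_onI)
    fix x y assume "x \<in> S" "y \<in> S" "f x = f y"
    then show "x = y" using ker[of "x - y"] S by (simp add: f.diff subspace_diff)
  qed
  then have "dim (f ` S) = dim S" by (rule P.dim_image_eq[OF f])
  then show ?thesis
    using fd.subspace_dim_equal[of "f ` S" S] f.subspace_image[OF S] S into by simp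
qed

text \<open>Riesz representation on \<open>B\<close>: the map \<open>T\<close> that uses the numbers
  \<open>polar x b\<close> as coordinates is injective by nondegeneracy, hence onto.\<close>

lemma polar_represents:
  assumes B: "subspace B" and nd: "nondegenerate_on B" and f: "Vector_Spaces.linear scale (*) f"
  shows "\<exists>x\<in>B. \<forall>y\<in>B. polar x y = f y"
proof -
  obtain S where "S \<subseteq> B" "independent S" "B \<subseteq> span S" "card S = dim B"
    by (rule basis_exists)
  note S = this(1-3) fd.finiteI_independent[OF this(2)]
  define T where "T x = (\<Sum>b\<in>S. polar x b *\<^sub>k b)" for x
  have coeff: "g b = h b" if "(\<Sum>b\<in>S. g b *\<^sub>k b) = (\<Sum>b\<in>S. h b *\<^sub>k b)" "b \<in> S" for g h b
  proof -
    have "(\<Sum>b\<in>S. (g b - h b) *\<^sub>k b) = 0"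
      using that(1) by (simp add: scale_left_diff_distrib sum_subtractf)
    then have "g b - h b = 0"
      using independentD[OF S(2,4) subset_refl, of "\<lambda>b. g b - h b" b] that(2) by blast
    then show ?thesis by simp
  qed
  have ext: "polar x y = g y"
    if g: "Vector_Spaces.linear scale (*) g" and "\<And>b. b \<in> S \<Longrightarrow> polar x b = g b" "y \<in> B" for x y g
  proof -
    interpret vector_space_pair scale "(*) :: 'k \<Rightarrow> 'k \<Rightarrow> 'k"
      using g by (simp add: vector_space_pair_def Vector_Spaces.linear_def)
    show ?thesis using linear_eq_on[OF linear_polar g, of y S x] that S by blast
  qed
  have lin0: "Vector_Spaces.linear scale (*) (\<lambda>x. 0 :: 'k)"
    using f by (simp add: Vector_Spaces.linear_iff)
  have "T ` B = B"
  proof (rule linear_on_subspace_surj[OF _ B])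
    show "Vector_Spaces.linear scale scale T"
      by (rule linearI) (simp_all add: T_def polar_add_left scale_left_distrib sum.distrib scale_sum_right)
    show "T ` B \<subseteq> B"
      using S(1) by (auto simp: T_def intro!: subspace_sum subspace_scale B)
    fix x assume x: "x \<in> B" "T x = 0"
    have "polar x b = 0" if "b \<in> S" for b
      using coeff[of "polar x" "\<lambda>_. 0" b] x(2) that by (simp add: T_def)
    then have "\<forall>y\<in>B. polar x y = 0" using ext[OF lin0] by blast
    then show "x = 0" using nd x(1) by (auto simp: nondegenerate_on_def)
  qed
  moreover have "(\<Sum>b\<in>S. f b *\<^sub>k b) \<in> B"
    using S(1) by (auto intro!: subspace_sum subspace_scale B)
  ultimately obtain x where x: "x \<in> B" "T x = (\<Sum>b\<in>S. f b *\<^sub>k b)"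
    by (metis imageE)
  then have "polar x b = f b" if "b \<in> S" for b
    using coeff[of "polar x" f b] that by (simp add: T_def)
  then show ?thesis using x(1) ext[OF f] by blast
qed

lemma orthogonal_projection:
  assumes "subspace B" "nondegenerate_on B"
  obtains b where "b \<in> B" "x - b \<in> orth B"
proof -
  obtain b where "b \<in> B" "\<forall>y\<in>B. polar b y = polar x y"
    using polar_represents[OF assms linear_polar] by blast
  then show thesis using that[of b] by (simp add: orth_iff polar_diff_left)
qed

text \<open>If the norm vanished on \<open>orth B\<close>, so would its polar form there. The
  component in \<open>orth B\<close> of a vector outside \<open>B\<close> would then be a nonzero
  vector orthogonal to everything.\<close>

lemma anisotropic_in_orth:
  assumes B: "subspace B" and nd: "nondegenerate_on B" and "B \<noteq> UNIV"
  obtains w where "w \<in> orth B" "N w \<noteq> 0"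
proof -
  obtain x where "x \<notin> B" using assms by auto
  obtain b where b: "b \<in> B" "x - b \<in> orth B" using orthogonal_projection[OF B nd] .
  have "x - b \<noteq> 0" using b \<open>x \<notin> B\<close> by auto
  have "\<exists>w\<in>orth B. N w \<noteq> 0"
  proof (rule ccontr)
    assume iso: "\<not> ?thesis"
    have "polar (x - b) y = 0" for y
    proof -
      obtain c where c: "c \<in> B" "y - c \<in> orth B" using orthogonal_projection[OF B nd] .
      have "(x - b) + (y - c) \<in> orth B" using b c subspace_orth subspace_add by blast
      then have "polar (x - b) (y - c) = 0"
        using iso b(2) c(2) by (simp add: polar_def)
      moreover have "polar (x - b) c = 0" using b(2) c(1) by (simp add: orth_iff)
      ultimately show ?thesis by (simp add: polar_diff_right)
    qed
    then have "x - b = 0" by (rule polar_nondegenerate)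
    with \<open>x - b \<noteq> 0\<close> show False by simp
  qed
  then show thesis using that by blast
qed

text \<open>Multiplicativity of the norm on \<^term>\<open>B + B \<star> w\<close> forces \<^term>\<open>B\<close> to be associative.\<close>

lemma subalgebra_assoc:
  assumes B: "unital_subalgebra B" and nd: "nondegenerate_on B"
    and w: "w \<in> orth B" and Nw: "N w \<noteq> 0"
    and v: "v \<in> B" and x: "x \<in> B" and u: "u \<in> B"
  shows "v \<star> (x \<star> u) = (v \<star> x) \<star> u"
proof -
  note cl = subalgebraD[OF B]
  have "polar (v \<star> (x \<star> u) - (v \<star> x) \<star> u) y = 0" if y: "y \<in> B" for y
  proof -
    \<comment> \<open>The right side of the exchange identity is zero because \<open>x\<close> is
      orthogonal to \<open>y \<star> w\<close>. The doubling rules leave a common factor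
      \<open>N w\<close>, and removing it gives associativity tested against
      \<open>y\<close>.\<close>
    have "polar (x \<star> u) ((y \<star> w) \<star> (v \<star> w)) + polar (x \<star> (v \<star> w)) ((y \<star> w) \<star> u) = 0"
      using polar_exchange[of x u "y \<star> w" "v \<star> w"] orth_polar[OF B orth_mul[OF B w y]] x by simp
    then have "N w * (polar (x \<star> u) (conj v \<star> y) - polar (v \<star> x) (y \<star> conj u)) = 0"
      using x v u y by (auto simp: double_double[OF B w] double_left[OF B w] double_right[OF B w]
          cl polar_mul_right_cancel algebra_simps)
    then have "polar (x \<star> u) (conj v \<star> y) = polar (v \<star> x) (y \<star> conj u)" using Nw by simp
    then show ?thesis by (simp add: polar_diff_left polar_adjoint_left[of v] polar_adjoint_right[of _ u])
  qed
  moreover have "v \<star> (x \<star> u) - (v \<star> x) \<star> u \<in> B" using v x u by (simp add: cl)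
  ultimately have "v \<star> (x \<star> u) - (v \<star> x) \<star> u = 0" using nd by (auto simp: nondegenerate_on_def)
  then show ?thesis by simp
qed

text \<open>The Cayley-Dickson double, written as a sum of \<open>B\<close> with an image so that
  facts about sums of subspaces and their dimensions apply directly.\<close>

definition double :: "'c set \<Rightarrow> 'c \<Rightarrow> 'c set" where
  "double B w = {x + y |x y. x \<in> B \<and> y \<in> (\<lambda>y. y \<star> w) ` B}"

lemma subspace_mul_right:
  assumes "subspace B"
  shows "subspace ((\<lambda>y. y \<star> w) ` B)"
proof -
  interpret Vector_Spaces.linear scale scale "\<lambda>y. y \<star> w" by (rule linear_mul_right)
  show ?thesis by (rule subspace_image[OF assms])
qed

lemma doubleI: "x \<in> B \<Longrightarrow> y \<in> B \<Longrightarrow> x + y \<star> w \<in> double B w"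
  by (auto simp: double_def)

lemma doubleE:
  assumes "a \<in> double B w"
  obtains x y where "x \<in> B" "y \<in> B" "a = x + y \<star> w"
  using assms by (auto simp: double_def)

context
  fixes B w
  assumes B: "unital_subalgebra B" and w: "w \<in> orth B"
begin

lemma double_mul:
  assumes "x \<in> B" "y \<in> B" "u \<in> B" "v \<in> B"
  shows "(x + y \<star> w) \<star> (u + v \<star> w) =
    (x \<star> u - N w *\<^sub>k (conj v \<star> y)) + (v \<star> x + y \<star> conj u) \<star> w"
  using assms
  by (simp add: mul_distribs double_left[OF B w] double_right[OF B w] double_double[OF B w]
      algebra_simps)

lemma double_polar:
  assumes "x \<in> B" "y \<in> B" "u \<in> B" "v \<in> B"
  shows "polar (x + y \<star> w) (u + v \<star> w) = polar x u + polar y v * N w"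
  using assms orth_polar[OF B orth_mul[OF B w]]
  by (simp add: polar_distribs polar_mul_right_cancel)

lemma double_N:
  assumes "x \<in> B" "y \<in> B"
  shows "N (x + y \<star> w) = N x + N y * N w"
  using assms orth_polar[OF B orth_mul[OF B w]] by (simp add: N_add N_mult)

lemma unital_subalgebra_double: "unital_subalgebra (double B w)"
proof -
  note cl = subalgebraD[OF B]
  have "subspace ((\<lambda>y. y \<star> w) ` B)"
    by (rule subspace_mul_right[OF cl(1)])
  then have "subspace (double B w)"
    unfolding double_def by (rule subspace_sums[OF cl(1)])
  moreover have "e1 \<in> double B w" using doubleI[of e1 B 0 w] cl by simp
  moreover have "a \<star> b \<in> double B w" if a: "a \<in> double B w" and b: "b \<in> double B w" for a b
  proof -
    obtain x y u v where "x \<in> B" "y \<in> B" "u \<in> B" "v \<in> B" "a = x + y \<star> w" "b = u + v \<star> w"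
      using a b by (meson doubleE)
    then show ?thesis by (simp add: double_mul cl doubleI)
  qed
  ultimately show ?thesis by (simp add: unital_subalgebra_def)
qed

lemma subset_double: "B \<subseteq> double B w"
  using doubleI[of _ B 0 w] subalgebraD(3)[OF B] by force

context
  assumes nd: "nondegenerate_on B" and Nw: "N w \<noteq> 0"
begin

lemma nondegenerate_on_double: "nondegenerate_on (double B w)"
  unfolding nondegenerate_on_def
proof (intro ballI impI)
  fix a assume a: "a \<in> double B w" and ortho: "\<forall>b\<in>double B w. polar a b = 0"
  obtain x y where xy: "x \<in> B" "y \<in> B" "a = x + y \<star> w" using a by (rule doubleE)
  note Z = subalgebraD(3)[OF B]
  have "polar x u = 0" if "u \<in> B" for u
    using ortho double_polar[of x y u 0] doubleI[of u B 0 w] xy that Z by force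
  then have "x = 0" using nd xy by (auto simp: nondegenerate_on_def)
  have "polar y v = 0" if "v \<in> B" for v
    using ortho double_polar[of x y 0 v] doubleI[of 0 B v w] xy that Z Nw by force
  then have "y = 0" using nd xy by (auto simp: nondegenerate_on_def)
  with \<open>x = 0\<close> xy show "a = 0" by simp
qed

lemma double_eq_zero:
  assumes "x \<in> B" "y \<in> B" "x + y \<star> w = 0"
  shows "x = 0" "y = 0"
proof -
  have "polar x u = 0" if "u \<in> B" for u
    using double_polar[of x y u 0] assms that subalgebraD(3)[OF B] by simp
  then show "x = 0" using nd assms by (auto simp: nondegenerate_on_def)
  have "polar y v = 0" if "v \<in> B" for v
    using double_polar[of x y 0 v] assms that subalgebraD(3)[OF B] Nw by simp
  then show "y = 0" using nd assms by (auto simp: nondegenerate_on_def)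
qed

lemma double_unique:
  assumes "x \<in> B" "y \<in> B" "x' \<in> B" "y' \<in> B" "x + y \<star> w = x' + y' \<star> w"
  shows "x = x'" "y = y'"
  using double_eq_zero[of "x - x'" "y - y'"] assms subalgebraD(3,6)[OF B]
  by (auto simp: mul_diff_left algebra_simps)

text \<open>The decomposition into \<open>B\<close> and its right translate by \<open>w\<close> is
  direct, and right multiplication by \<open>w\<close> is injective on \<open>B\<close>.\<close>

lemma dim_double: "dim (double B w) = 2 * dim B"
proof -
  interpret P: finite_dimensional_vector_space_pair_1 scale std_basis scale ..
  note cl = subalgebraD[OF B]
  have sub: "subspace ((\<lambda>y. y \<star> w) ` B)"
    by (rule subspace_mul_right[OF cl(1)])
  have "inj_on (\<lambda>y. y \<star> w) (span B)"
    unfolding span_eq_iff[THEN iffD2, OF cl(1)]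
    using double_unique(2)[of 0 _ 0] cl(3) by (auto intro!: inj_onI)
  then have d: "dim ((\<lambda>y. y \<star> w) ` B) = dim B" by (rule P.dim_image_eq[OF linear_mul_right])
  have "B \<inter> (\<lambda>y. y \<star> w) ` B = {0}"
  proof
    show "B \<inter> (\<lambda>y. y \<star> w) ` B \<subseteq> {0}"
      using double_unique(1)[of _ 0 0] cl(3) by force
    show "{0} \<subseteq> B \<inter> (\<lambda>y. y \<star> w) ` B" using cl(3) by force
  qed
  moreover have "dim (double B w) + dim (B \<inter> (\<lambda>y. y \<star> w) ` B) = dim B + dim ((\<lambda>y. y \<star> w) ` B)"
    unfolding double_def by (rule fd.dim_sums_Int[OF cl(1) sub])
  ultimately show ?thesis using d by simp
qed

end
end

section \<open>Automorphisms preserving a quaternion subalgebra\<close>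

lemma AutI:
  assumes "Vector_Spaces.linear scale scale f" "f \<circ> f = id" "f e1 = e1"
    "\<And>x y. f (x \<star> y) = f x \<star> f y"
  shows "f \<in> Aut" "involution f"
proof -
  have "bij f" using assms(2) by (rule o_bij[OF _ assms(2)])
  then show "f \<in> Aut" using assms by (simp add: Aut_def)
  then show "involution f" using assms by (simp add: involution_def)
qed

lemma AutD:
  assumes "f \<in> Aut"
  shows "f (x + y) = f x + f y" "f (c *\<^sub>k x) = c *\<^sub>k f x" "f (x \<star> y) = f x \<star> f y" "f e1 = e1"
    "bij f" "f (x - y) = f x - f y" "f (- x) = - f x" "f 0 = 0"
proof -
  have l: "Vector_Spaces.linear scale scale f" using assms by (simp add: Aut_def)
  interpret Vector_Spaces.linear scale scale f by (fact l)
  show "f (x + y) = f x + f y" "f (c *\<^sub>k x) = c *\<^sub>k f x" "f (x - y) = f x - f y" "f (- x) = - f x" "f 0 = 0"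
    by (simp_all add: add scale diff neg)
  show "f (x \<star> y) = f x \<star> f y" "f e1 = e1" "bij f" using assms by (auto simp: Aut_def)
qed

lemma quadratic_relation: "x \<star> x = tr x *\<^sub>k x - N x *\<^sub>k e1"
  using mul_conj_self[of x] by (simp add: conj_def mul_diff_right algebra_simps)

text \<open>The norm is determined by the multiplication, through \<open>x\<^sup>2 = tr x x - N x\<close>.\<close>

lemma Aut_norm:
  assumes f: "f \<in> Aut"
  shows "tr (f x) = tr x" "N (f x) = N x"
proof -
  have rel: "(tr (f x) - tr x) *\<^sub>k f x = (N (f x) - N x) *\<^sub>k e1" for x
  proof -
    have "f x \<star> f x = tr x *\<^sub>k f x - N x *\<^sub>k e1"
      using arg_cong[OF quadratic_relation[of x], of f] by (simp add: AutD[OF f])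
    then show ?thesis using quadratic_relation[of "f x"]
      by (simp add: scale_left_diff_distrib algebra_simps)
  qed
  have tr_eq: "tr (f x) = tr x" for x
  proof (cases "tr (f x) = tr x")
    case False
    \<comment> \<open>If the traces differed, \<open>rel\<close> would make \<open>f x\<close> a
      multiple of \<open>e1\<close>. Then \<open>x\<close> is the same multiple by injectivity, so
      the traces agree after all.\<close>
    define c where "c = (N (f x) - N x) / (tr (f x) - tr x)"
    have "f x = c *\<^sub>k e1"
    proof -
      have "(1 / (tr (f x) - tr x)) *\<^sub>k ((tr (f x) - tr x) *\<^sub>k f x) = c *\<^sub>k e1"
        by (simp add: rel c_def)
      then show ?thesis using False by simp
    qed
    then have "f x = f (c *\<^sub>k e1)" by (simp add: AutD[OF f])
    then have "x = c *\<^sub>k e1" using AutD(5)[OF f] by (auto dest: bij_is_inj injD)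
    then show ?thesis using \<open>f x = c *\<^sub>k e1\<close> by simp
  qed
  show "tr (f x) = tr x" by (rule tr_eq)
  then show "N (f x) = N x" using rel[of x] e1_nonzero by simp
qed

lemma Aut_polar: "f \<in> Aut \<Longrightarrow> polar (f x) (f y) = polar x y"
  by (simp add: polar_def Aut_norm flip: AutD(1))

text \<open>
  For \<open>q\<close>, \<open>z\<close> in a quaternion subalgebra \<open>M\<close> and \<open>w\<close> orthogonal to \<open>M\<close>, this is the map
  \<open>x + y w \<mapsto> q x q\<inverse> + (z y q\<inverse>) w\<close>, which is an automorphism if \<open>q\<close> and \<open>z\<close> have the same norm.
\<close>

definition twist :: "'c set \<Rightarrow> 'c \<Rightarrow> 'c \<Rightarrow> 'c \<Rightarrow> 'c \<Rightarrow> 'c" where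
  "twist M w q z a = (THE b. \<exists>x\<in>M. \<exists>y\<in>M. a = x + y \<star> w \<and>
     b = (1 / N q) *\<^sub>k (q \<star> x \<star> conj q + (z \<star> y \<star> conj q) \<star> w))"

context
  fixes M w
  assumes M: "unital_subalgebra M" and nd: "nondegenerate_on M"
    and w: "w \<in> orth M" and Nw: "N w \<noteq> 0" and total: "double M w = UNIV"
begin

lemma decompose:
  obtains x y where "x \<in> M" "y \<in> M" "a = x + y \<star> w"
proof -
  have "a \<in> double M w" by (simp add: total)
  then show thesis by (rule doubleE) (rule that)
qed

lemma twist_apply:
  assumes "x \<in> M" "y \<in> M"
  shows "twist M w q z (x + y \<star> w) = (1 / N q) *\<^sub>k (q \<star> x \<star> conj q + (z \<star> y \<star> conj q) \<star> w)"
  unfolding twist_def using double_unique[OF M w nd Nw] assms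
  by (intro the_equality) blast+

lemmas M_closed = subalgebraD[OF M]
lemmas M_assoc = subalgebra_assoc[OF M nd w Nw, symmetric]

lemma twist_linear: "Vector_Spaces.linear scale scale (twist M w q z)"
proof (rule linearI)
  fix a b
  obtain x y where a: "x \<in> M" "y \<in> M" "a = x + y \<star> w" by (rule decompose)
  obtain u v where b: "u \<in> M" "v \<in> M" "b = u + v \<star> w" by (rule decompose)
  have "a + b = (x + u) + (y + v) \<star> w" using a b by (simp add: mul_add_left algebra_simps)
  then have "twist M w q z (a + b) =
    (1 / N q) *\<^sub>k (q \<star> (x + u) \<star> conj q + (z \<star> (y + v) \<star> conj q) \<star> w)"
    using a b by (simp only: twist_apply M_closed)
  then show "twist M w q z (a + b) = twist M w q z a + twist M w q z b"
    using a b by (simp add: twist_apply mul_distribs scale_right_distrib)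
next
  fix c a
  obtain x y where a: "x \<in> M" "y \<in> M" "a = x + y \<star> w" by (rule decompose)
  have "c *\<^sub>k a = c *\<^sub>k x + (c *\<^sub>k y) \<star> w" using a by (simp add: scale_right_distrib)
  then have "twist M w q z (c *\<^sub>k a) = (1 / N q) *\<^sub>k (q \<star> (c *\<^sub>k x) \<star> conj q + (z \<star> (c *\<^sub>k y) \<star> conj q) \<star> w)"
    using a by (simp only: twist_apply M_closed)
  then show "twist M w q z (c *\<^sub>k a) = c *\<^sub>k twist M w q z a"
    using a by (simp add: twist_apply scale_right_distrib mult.commute)
qed

lemma cancel_inner:
  assumes "x \<in> M" "y \<in> M" "q \<in> M"
  shows "(x \<star> conj q) \<star> (q \<star> y) = N q *\<^sub>k (x \<star> y)"
  using assms mul_cancel_conj'[of x q] M_assoc[of "x \<star> conj q" q y] by (simp add: M_closed)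

lemma twist_mul:
  assumes q: "q \<in> M" "N q \<noteq> 0" and z: "z \<in> M" "N z = N q"
  shows "twist M w q z (a \<star> b) = twist M w q z a \<star> twist M w q z b"
proof -
  obtain x y where a: "x \<in> M" "y \<in> M" "a = x + y \<star> w" by (rule decompose)
  obtain u v where b: "u \<in> M" "v \<in> M" "b = u + v \<star> w" by (rule decompose)
  note c = M_closed q z a b
  define n where "n = N q"
  have n: "n \<noteq> 0" using q by (simp add: n_def)
  \<comment> \<open>These are the four products in the Cayley-Dickson formula. In \<open>p1\<close>,
    \<open>p3\<close> and \<open>p4\<close> a factor \<open>conj q \<star> q\<close> cancels in the
    middle; in \<open>p2\<close> it is \<open>conj z \<star> z\<close>, which gives the same scalar
    because \<open>N z = N q\<close>.\<close>
  have p1: "(q \<star> x \<star> conj q) \<star> (q \<star> u \<star> conj q) = n *\<^sub>k (q \<star> (x \<star> u) \<star> conj q)"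
    using cancel_inner[of "q \<star> x" "u \<star> conj q" q] c by (simp add: M_assoc n_def flip: M_assoc)
  have p2: "conj (z \<star> v \<star> conj q) \<star> (z \<star> y \<star> conj q) = n *\<^sub>k (q \<star> (conj v \<star> y) \<star> conj q)"
    using cancel_inner[of "q \<star> conj v" "y \<star> conj q" z] c by (simp add: conj_mul n_def flip: M_assoc)
  have p3: "(z \<star> v \<star> conj q) \<star> (q \<star> x \<star> conj q) = n *\<^sub>k (z \<star> (v \<star> x) \<star> conj q)"
    using cancel_inner[of "z \<star> v" "x \<star> conj q" q] c by (simp add: n_def flip: M_assoc)
  have p4: "(z \<star> y \<star> conj q) \<star> conj (q \<star> u \<star> conj q) = n *\<^sub>k (z \<star> (y \<star> conj u) \<star> conj q)"
    using cancel_inner[of "z \<star> y" "conj u \<star> conj q" q] c by (simp add: conj_mul n_def flip: M_assoc)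
  have "twist M w q z a \<star> twist M w q z b = (1 / n * (1 / n)) *\<^sub>k
    ((q \<star> x \<star> conj q + (z \<star> y \<star> conj q) \<star> w) \<star> (q \<star> u \<star> conj q + (z \<star> v \<star> conj q) \<star> w))"
    using c by (simp add: twist_apply n_def)
  also have "\<dots> = (1 / n) *\<^sub>k (q \<star> (x \<star> u - N w *\<^sub>k (conj v \<star> y)) \<star> conj q
      + (z \<star> (v \<star> x + y \<star> conj u) \<star> conj q) \<star> w)"
    using c n by (simp add: double_mul[OF M w] p1 p2 p3 p4)
      (simp add: mul_distribs scale_right_distrib scale_right_diff_distrib mult.commute)
  also have "\<dots> = twist M w q z (a \<star> b)"
    unfolding a b using c by (simp add: double_mul[OF M w] twist_apply n_def)
  finally show ?thesis by simp
qed

lemma twist_comp: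
  assumes "q \<in> M" "z \<in> M" "c \<in> M" "d \<in> M"
  shows "twist M w q z (twist M w c d a) = twist M w (q \<star> c) (z \<star> d) a"
proof -
  obtain x y where a: "x \<in> M" "y \<in> M" "a = x + y \<star> w" by (rule decompose)
  note cl = M_closed a assms
  have eq: "twist M w c d a = (1 / N c) *\<^sub>k (c \<star> x \<star> conj c) + ((1 / N c) *\<^sub>k (d \<star> y \<star> conj c)) \<star> w"
    using cl by (simp add: twist_apply scale_right_distrib)
  have "twist M w q z (twist M w c d a) =
    (1 / N q) *\<^sub>k (q \<star> ((1 / N c) *\<^sub>k (c \<star> x \<star> conj c)) \<star> conj q +
       (z \<star> ((1 / N c) *\<^sub>k (d \<star> y \<star> conj c)) \<star> conj q) \<star> w)"
    unfolding eq using cl by (subst twist_apply) simp_all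
  also have "\<dots> = twist M w (q \<star> c) (z \<star> d) a"
    using cl by (simp add: twist_apply N_mult scale_right_distrib conj_mul M_assoc)
  finally show ?thesis .
qed

text \<open>The square is the twist by the squares of \<open>q\<close> and \<open>z\<close>. Trace
  zero and equal norms make both squares the scalar \<open>- N q\<close>, and a pair of equal
  nonzero scalars acts trivially.\<close>

lemma twist_involution:
  assumes q: "q \<in> M" "N q \<noteq> 0" "tr q = 0" and z: "z \<in> M" "N z = N q" "tr z = 0"
  shows "involution (twist M w q z)"
proof (rule AutI)
  show "Vector_Spaces.linear scale scale (twist M w q z)" by (rule twist_linear)
  show "twist M w q z (a \<star> b) = twist M w q z a \<star> twist M w q z b" for a b
    by (rule twist_mul) (use q z in auto)
  have "twist M w q z (e1 + 0 \<star> w) = e1"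
    using q by (subst twist_apply) (simp_all add: M_closed mul_conj_self)
  then show "twist M w q z e1 = e1" by simp
  have sq: "q \<star> q = - (N q *\<^sub>k e1)" "z \<star> z = - (N q *\<^sub>k e1)"
    using pure_square[of q e1] pure_square[of z e1] q z by simp_all
  show "twist M w q z \<circ> twist M w q z = id"
  proof
    fix a
    obtain x y where a: "x \<in> M" "y \<in> M" "a = x + y \<star> w" by (rule decompose)
    have "twist M w q z (twist M w q z a) = twist M w (- (N q *\<^sub>k e1)) (- (N q *\<^sub>k e1)) a"
      using q z by (simp add: twist_comp sq)
    also have "\<dots> = a"
      using a q by (simp add: twist_apply N_scale power2_eq_square scale_right_distrib)
    finally show "(twist M w q z \<circ> twist M w q z) a = id a" by simp
  qed
qed

end

section \<open>Automorphisms fixing a quadratic subalgebra\<close>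

definition reversible :: "('c \<Rightarrow> 'c) \<Rightarrow> bool" where
  "reversible f \<longleftrightarrow> (\<exists>g h. involution g \<and> involution h \<and> f = g \<circ> h)"

context
  fixes L
  assumes L: "quadratic_etale L"
begin

lemma L_subalgebra: "unital_subalgebra L"
  and L_nondegenerate: "nondegenerate_on L"
  and dim_L: "dim L = 2"
  using L by (auto simp: quadratic_etale_def unital_subalgebra_def nondegenerate_on_def)

lemmas L_closed = subalgebraD[OF L_subalgebra]

text \<open>Subtracting half of the trace from an element outside the line of \<open>e1\<close>
  needs characteristic not 2. If the result had norm zero, it would be orthogonal to all of
  \<open>L\<close>.\<close>

lemma quadratic_generator:
  obtains \<gamma> where "\<gamma> \<in> L" "tr \<gamma> = 0" "N \<gamma> \<noteq> 0" "\<And>x. x \<in> L \<Longrightarrow> \<exists>a b. x = a *\<^sub>k e1 + b *\<^sub>k \<gamma>"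
proof -
  have "\<not> L \<subseteq> span {e1}"
    using dim_le_card[of L "{e1}"] dim_L by auto
  then obtain b where b: "b \<in> L" "b \<notin> span {e1}" by blast
  define \<gamma> where "\<gamma> = b - (tr b / 2) *\<^sub>k e1"
  have \<gamma>L: "\<gamma> \<in> L" using b by (simp add: \<gamma>_def L_closed)
  have tr\<gamma>: "tr \<gamma> = 0" using two_neq_zero by (simp add: \<gamma>_def tr_diff)
  have e: "(tr b / 2) *\<^sub>k e1 \<in> span {e1}" by (simp add: span_base span_scale)
  have "\<gamma> \<notin> span {e1}"
  proof
    assume "\<gamma> \<in> span {e1}"
    then have "\<gamma> + (tr b / 2) *\<^sub>k e1 \<in> span {e1}" using e by (rule span_add)
    then show False using b by (simp add: \<gamma>_def)
  qed
  moreover have "independent {e1}" by (simp add: e1_nonzero)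
  ultimately have "\<gamma> \<noteq> e1" "independent {\<gamma>, e1}"
    using span_base[of e1 "{e1}"] independent_insertI[of \<gamma> "{e1}"] by auto
  then have "L \<subseteq> span {\<gamma>, e1}"
    using \<gamma>L L_closed dim_L by (intro fd.card_ge_dim_independent) auto
  then have repr: "\<exists>a b. x = a *\<^sub>k e1 + b *\<^sub>k \<gamma>" if "x \<in> L" for x
    using that by (fastforce simp: span_breakdown_eq algebra_simps)
  have "N \<gamma> \<noteq> 0"
  proof
    assume "N \<gamma> = 0"
    then have "polar \<gamma> x = 0" if "x \<in> L" for x
      using repr[OF that] tr\<gamma> by (auto simp: polar_add_right polar_self simp flip: tr_def)
    then have "\<gamma> = 0" using L_nondegenerate \<gamma>L by (auto simp: nondegenerate_on_def)
    then show False using \<open>\<gamma> \<notin> span {e1}\<close> by (simp add: span_zero)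
  qed
  then show thesis using that[OF \<gamma>L tr\<gamma>] repr by blast
qed

lemma L_commute: "x \<in> L \<Longrightarrow> y \<in> L \<Longrightarrow> x \<star> y = y \<star> x"
proof -
  assume xy: "x \<in> L" "y \<in> L"
  obtain \<gamma> where g: "\<And>x. x \<in> L \<Longrightarrow> \<exists>a b. x = a *\<^sub>k e1 + b *\<^sub>k \<gamma>" by (rule quadratic_generator) blast
  obtain a b c d where "x = a *\<^sub>k e1 + b *\<^sub>k \<gamma>" "y = c *\<^sub>k e1 + d *\<^sub>k \<gamma>"
    using g[OF xy(1)] g[OF xy(2)] by blast
  then show ?thesis by (simp add: mul_distribs scale_right_distrib algebra_simps)
qed

lemma L_neq_UNIV: "L \<noteq> UNIV"
  using dim_L dim_8 by auto

lemma L_assoc: "x \<in> L \<Longrightarrow> y \<in> L \<Longrightarrow> z \<in> L \<Longrightarrow> x \<star> (y \<star> z) = x \<star> y \<star> z"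
proof -
  obtain w where "w \<in> orth L" "N w \<noteq> 0"
    using anisotropic_in_orth[OF L_closed(1) L_nondegenerate L_neq_UNIV] .
  then show "x \<in> L \<Longrightarrow> y \<in> L \<Longrightarrow> z \<in> L \<Longrightarrow> x \<star> (y \<star> z) = x \<star> y \<star> z"
    by (rule subalgebra_assoc[OF L_subalgebra L_nondegenerate])
qed

text \<open>On \<open>orth L\<close> the doubling rule reverses the order of \<open>x\<close> and
  \<open>y\<close>, which is harmless because \<open>L\<close> is commutative; on \<open>L\<close>
  this is associativity.\<close>

lemma L_module: "x \<in> L \<Longrightarrow> y \<in> L \<Longrightarrow> x \<star> (y \<star> z) = x \<star> y \<star> z"
proof -
  assume xy: "x \<in> L" "y \<in> L"
  obtain l where l: "l \<in> L" "z - l \<in> orth L"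
    using orthogonal_projection[OF L_closed(1) L_nondegenerate] .
  have "x \<star> (y \<star> (l + (z - l))) = x \<star> y \<star> (l + (z - l))"
    unfolding mul_add_right using L_assoc[OF xy l(1)] double_left[OF L_subalgebra l(2) xy] L_commute[OF xy]
    by simp
  then show ?thesis by simp
qed

text \<open>Hilbert 90 for \<open>L\<close>, field or split. The element \<open>e1 + a\<close> works
  because \<open>a \<star> conj a = e1\<close>. Its norm vanishes only for \<open>a = - e1\<close>,
  and then the trace-zero generator takes its place.\<close>

lemma norm_one_quotient:
  assumes a: "a \<in> L" "N a = 1"
  obtains c where "c \<in> L" "N c \<noteq> 0" "a \<star> conj c = c"
proof -
  obtain \<gamma> where \<gamma>: "\<gamma> \<in> L" "tr \<gamma> = 0" "N \<gamma> \<noteq> 0" "\<And>x. x \<in> L \<Longrightarrow> \<exists>a b. x = a *\<^sub>k e1 + b *\<^sub>k \<gamma>"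
    by (rule quadratic_generator) blast
  show thesis
  proof (cases "a = - e1")
    case True
    show thesis using that[of \<gamma>] \<gamma> True by (simp add: conj_pure)
  next
    case False
    obtain s r where sr: "a = s *\<^sub>k e1 + r *\<^sub>k \<gamma>" using \<gamma>(4)[OF a(1)] by blast
    have p: "polar e1 \<gamma> = 0" using \<gamma>(2) by (simp add: tr_def polar_commute)
    have "N (e1 + a) \<noteq> 0"
    proof
      assume "N (e1 + a) = 0"
      then have "2 * (1 + s) = 0"
        using a(2) by (simp add: N_add[of e1]) (simp add: sr polar_add_right p polar_self algebra_simps)
      then have "1 + s = 0" using two_neq_zero mult_eq_0_iff[of 2 "1 + s"] by blast
      then have s: "s = - 1" by (simp add: add_eq_0_iff)
      have "s\<^sup>2 + r\<^sup>2 * N \<gamma> = 1" using a(2) by (simp add: sr N_add N_scale p)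
      then have "r = 0" using \<gamma>(3) by (simp add: s)
      with s sr False show False by simp
    qed
    moreover have "a \<star> conj (e1 + a) = e1 + a"
      using a(2) by (simp add: conj_add mul_add_right mul_conj_self)
    ultimately show thesis using that[of "e1 + a"] a(1) by (simp add: L_closed)
  qed
qed

text \<open>As \<open>tr (z \<star> d) = polar z (conj d)\<close>, the second trace condition is
  orthogonality to \<open>conj d\<close>. In the orthogonal basis \<open>e1\<close>, \<gamma>,
  \<open>v\<close>, \<open>\<gamma> \<star> v\<close> the problem becomes
  \<open>common_value_of_binary_forms\<close> with \<open>\<alpha> = N \<gamma>\<close> and
  \<open>\<beta> = N v\<close>. The coordinate \<open>D0\<close> of \<open>conj d\<close> drops out
  because \<open>z\<close> has trace zero.\<close>

lemma common_norm_of_pure_elements: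
  assumes v: "v \<in> orth L" "N v \<noteq> 0" and d: "d \<in> double L v"
  obtains q z where "q \<in> double L v" "q \<in> orth L" "z \<in> double L v" "tr z = 0" "tr (z \<star> d) = 0"
    "N z = N q" "N q \<noteq> 0"
proof -
  note cl = L_closed
  obtain \<gamma> where \<gamma>: "\<gamma> \<in> L" "tr \<gamma> = 0" "N \<gamma> \<noteq> 0" "\<And>x. x \<in> L \<Longrightarrow> \<exists>a b. x = a *\<^sub>k e1 + b *\<^sub>k \<gamma>"
    by (rule quadratic_generator) blast
  have p: "polar e1 \<gamma> = 0" "polar \<gamma> e1 = 0" using \<gamma>(2) by (simp_all add: tr_def polar_commute)
  have "conj d \<in> double L v"
    using subalgebraD(9)[OF unital_subalgebra_double[OF L_subalgebra v(1)] d] .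
  then obtain x y where xy: "x \<in> L" "y \<in> L" "conj d = x + y \<star> v" by (rule doubleE)
  obtain D0 D1 D2 D3 where D: "x = D0 *\<^sub>k e1 + D1 *\<^sub>k \<gamma>" "y = D2 *\<^sub>k e1 + D3 *\<^sub>k \<gamma>"
    using \<gamma>(4)[OF xy(1)] \<gamma>(4)[OF xy(2)] by blast
  obtain z s r s' r' where
    1: "N \<gamma> * z * D1 + N v * (s * D2 + N \<gamma> * r * D3) = 0" and
    2: "N \<gamma> * z\<^sup>2 + N v * (s\<^sup>2 + N \<gamma> * r\<^sup>2) = N v * (s'\<^sup>2 + N \<gamma> * r'\<^sup>2)" and
    3: "N v * (s'\<^sup>2 + N \<gamma> * r'\<^sup>2) \<noteq> 0"
    using common_value_of_binary_forms[OF \<gamma>(3) v(2) two_neq_zero, of D1 D2 D3] by blast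
  define y0 where "y0 = s' *\<^sub>k e1 + r' *\<^sub>k \<gamma>"
  define y1 where "y1 = s *\<^sub>k e1 + r *\<^sub>k \<gamma>"
  have yL: "y0 \<in> L" "y1 \<in> L" "z *\<^sub>k \<gamma> \<in> L" using \<gamma> by (auto simp: y0_def y1_def cl)
  have Ny: "N y0 = s'\<^sup>2 + N \<gamma> * r'\<^sup>2" "N y1 = s\<^sup>2 + N \<gamma> * r\<^sup>2"
    by (simp_all add: y0_def y1_def N_add N_scale p mult.commute)
  define q where "q = y0 \<star> v"
  define z' where "z' = z *\<^sub>k \<gamma> + y1 \<star> v"
  have "q \<in> double L v" using doubleI[of 0 L y0 v] yL cl by (simp add: q_def)
  moreover have "q \<in> orth L" unfolding q_def by (rule orth_mul[OF L_subalgebra v(1) yL(1)])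
  moreover have "z' \<in> double L v" unfolding z'_def by (rule doubleI) (use yL in auto)
  moreover have "tr z' = 0"
    using orth_polar(1)[OF L_subalgebra orth_mul[OF L_subalgebra v(1) yL(2)]] cl \<gamma>(2)
    by (simp add: z'_def tr_add) (simp add: tr_def)
  moreover have "tr (z' \<star> d) = 0"
  proof -
    have "tr (z' \<star> d) = polar z' (x + y \<star> v)"
      using polar_adjoint_right[of z' d e1] xy by (simp add: tr_def)
    also have "\<dots> = 2 * (N \<gamma> * z * D1 + N v * (s * D2 + N \<gamma> * r * D3))"
      unfolding z'_def using yL xy
      by (simp add: double_polar[OF L_subalgebra v(1)])
        (simp add: D y1_def polar_distribs polar_self p algebra_simps)
    finally show ?thesis using 1 by simp
  qed
  moreover have "N z' = N q"
    using 2 yL unfolding z'_def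
    by (simp add: double_N[OF L_subalgebra v(1)] q_def N_mult N_scale Ny mult.commute)
  moreover have "N q \<noteq> 0" using 3 by (simp add: q_def N_mult Ny)
  ultimately show thesis by (rule that)
qed

lemma dim_full_eq_UNIV: "subspace S \<Longrightarrow> dim S = 8 \<Longrightarrow> S = UNIV"
  using fd.subspace_dim_equal[of S UNIV] dim_8 by simp

proposition reversible_if_anisotropic_eigenvector:
  assumes t: "t \<in> Aut" and fix_L: "\<And>x. x \<in> L \<Longrightarrow> t x = x"
    and v: "v \<in> orth L" and Nv: "N v \<noteq> 0" and a: "a \<in> L" and eigen: "t v = a \<star> v"
  shows "reversible t"
proof -
  define M where "M = double L v"
  note cl = L_closed
  have M: "unital_subalgebra M" and nd: "nondegenerate_on M" and dim_M: "dim M = 4"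
    unfolding M_def
    using unital_subalgebra_double[OF L_subalgebra v] dim_L
      nondegenerate_on_double[OF L_subalgebra v L_nondegenerate Nv]
      dim_double[OF L_subalgebra v L_nondegenerate Nv] by simp_all
  note Mcl = subalgebraD[OF M]
  have "M \<noteq> UNIV" using dim_M dim_8 by auto
  then obtain w where w: "w \<in> orth M" and Nw: "N w \<noteq> 0"
    using anisotropic_in_orth[OF Mcl(1) nd] by blast
  have total: "double M w = UNIV"
    using dim_full_eq_UNIV[OF subalgebraD(1)[OF unital_subalgebra_double[OF M w]]]
      dim_double[OF M w nd Nw] dim_M by simp
  have LM: "x \<in> M" if "x \<in> L" for x
    using subset_double[OF L_subalgebra v] that by (auto simp: M_def)
  have Na: "N a = 1"
    using Aut_norm(2)[OF t, of v] Nv by (simp add: eigen N_mult)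
  obtain c where c: "c \<in> L" "N c \<noteq> 0" "a \<star> conj c = c" by (rule norm_one_quotient[OF a Na])
  have cc: "c \<star> c = N c *\<^sub>k a"
    using mul_cancel_conj'[of a c] c(3) by simp
  have t_M: "t (x + y \<star> v) = x + (a \<star> y) \<star> v" if "x \<in> L" "y \<in> L" for x y
    using that double_left[OF L_subalgebra v that(2) a] by (simp add: AutD[OF t] fix_L eigen)
  \<comment> \<open>Conjugation by \<open>c\<close> is trivial on \<open>L\<close> by commutativity.
    On \<open>y \<star> v\<close> it multiplies \<open>y\<close> by the square of \<open>c\<close>
    over \<open>N c\<close>, which is \<open>a\<close> by \<open>cc\<close>.\<close>
  have t_inner: "t m = (1 / N c) *\<^sub>k (c \<star> m \<star> conj c)" if m: "m \<in> M" for m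
  proof -
    obtain x y where xy: "x \<in> L" "y \<in> L" "m = x + y \<star> v"
      using m unfolding M_def by (rule doubleE)
    have "c \<star> x \<star> conj c = N c *\<^sub>k x" using L_commute[OF c(1) xy(1)] mul_cancel_conj[of x c] by simp
    moreover have "c \<star> (y \<star> v) \<star> conj c = (y \<star> c \<star> c) \<star> v"
      using double_right[OF L_subalgebra v, of "conj c" "y \<star> c"] c xy
      by (simp add: double_left[OF L_subalgebra v] cl)
    moreover have "y \<star> c \<star> c = N c *\<^sub>k (a \<star> y)"
      using L_assoc[OF xy(2) c(1) c(1)] L_commute[OF a xy(2)] by (simp add: cc)
    ultimately show ?thesis
      using c(2) xy(3) t_M[OF xy(1,2)] by (simp add: mul_distribs scale_right_distrib)
  qed
  have t_into: "t m \<in> M" if "m \<in> M" for m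
    using t_inner[OF that] that c LM by (simp add: Mcl)
  have "t w \<in> orth M"
    unfolding orth_iff
  proof
    fix m assume m: "m \<in> M"
    obtain x y where xy: "x \<in> L" "y \<in> L" "m = x + y \<star> v"
      using m unfolding M_def by (rule doubleE)
    \<comment> \<open>Since \<open>N a = 1\<close>, replacing \<open>y\<close> by
      \<open>conj a \<star> y\<close> gives the preimage of \<open>m\<close> in \<open>M\<close>;
      thus \<open>t\<close> maps \<open>M\<close> onto \<open>M\<close> and preserves its
      complement.\<close>
    have ay: "conj a \<star> y \<in> L" using a xy by (simp add: cl)
    have "t (x + (conj a \<star> y) \<star> v) = m"
      using t_M[OF xy(1) ay] mul_conj_cancel[of a y] xy Na by simp
    moreover have "x + (conj a \<star> y) \<star> v \<in> M" unfolding M_def using xy(1) ay by (rule doubleI)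
    ultimately show "polar (t w) m = 0"
      using Aut_polar[OF t, of w "x + (conj a \<star> y) \<star> v"] orth_polar(1)[OF M w] by simp
  qed
  have "t w \<in> double M w" by (simp add: total)
  then obtain p0 p where p: "p0 \<in> M" "p \<in> M" "t w = p0 + p \<star> w" by (rule doubleE)
  have "polar p0 m = 0" if "m \<in> M" for m
    using orth_polar(1)[OF M \<open>t w \<in> orth M\<close> that] orth_polar(1)[OF M orth_mul[OF M w p(2)] that]
    by (simp add: p(3) polar_add_left)
  then have "p0 = 0" using nd p(1) by (auto simp: nondegenerate_on_def)
  then have tw: "t w = p \<star> w" using p by simp
  have Np: "N p = 1" using Aut_norm(2)[OF t, of w] Nw by (simp add: tw N_mult)
  \<comment> \<open>Chosen so that the twist by \<open>c\<close> and \<open>d\<close> sends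
    \<open>w\<close> to \<open>p \<star> w\<close>: the factor \<open>c\<close> cancels against
    \<open>conj c\<close> up to \<open>N c\<close>.\<close>
  define d where "d = p \<star> c"
  have d: "d \<in> M" "N d = N c" using p c LM Np by (simp_all add: d_def Mcl N_mult)
  have t_twist: "t b = twist M w c d b" for b
  proof -
    obtain x y where xy: "x \<in> M" "y \<in> M" "b = x + y \<star> w" by (rule decompose[OF M nd w Nw total])
    have "p \<star> t y = (1 / N c) *\<^sub>k (d \<star> y \<star> conj c)"
      using xy p c LM by (simp add: t_inner d_def Mcl subalgebra_assoc[OF M nd w Nw])
    moreover have "t b = t x + (p \<star> t y) \<star> w"
      using xy p(2) t_into by (simp add: AutD[OF t] tw double_left[OF M w])
    ultimately show ?thesis
      using xy c(2) by (simp add: twist_apply[OF M nd w Nw total] t_inner scale_right_distrib)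
  qed
  obtain q z where q: "q \<in> M" "q \<in> orth L" "N q \<noteq> 0" and
    z: "z \<in> M" "tr z = 0" "tr (z \<star> d) = 0" "N z = N q"
    using common_norm_of_pure_elements[OF v Nv] d(1) unfolding M_def by metis
  have tr_q: "tr q = 0" using orth_tr[OF L_subalgebra q(2)] .
  \<comment> \<open>Up to the pairing with \<open>conj c\<close>, which lies in \<open>L\<close>,
    this is the orthogonality of \<open>q\<close> to \<open>L\<close>.\<close>
  have tr_qc: "tr (q \<star> c) = 0"
    using polar_adjoint_right[of q c e1] orth_polar(1)[OF L_subalgebra q(2)] c(1)
    by (simp add: tr_def cl)
  let ?g = "twist M w q z"
  have g: "involution ?g"
    by (rule twist_involution[OF M nd w Nw total]) (use q z tr_q in auto)
  have "?g \<circ> t = twist M w (q \<star> c) (z \<star> d)"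
  proof
    show "(?g \<circ> t) b = twist M w (q \<star> c) (z \<star> d) b" for b
      using twist_comp[OF M nd w Nw total q(1) z(1) LM[OF c(1)] d(1), of b] by (simp add: t_twist)
  qed
  moreover have "involution (twist M w (q \<star> c) (z \<star> d))"
    by (rule twist_involution[OF M nd w Nw total]) (use q z tr_qc c d LM in \<open>auto simp: Mcl N_mult\<close>)
  ultimately have "involution (?g \<circ> t)" by simp
  moreover have "t = ?g \<circ> (?g \<circ> t)"
    using g by (simp add: involution_def flip: comp_assoc)
  ultimately show ?thesis using g unfolding reversible_def by blast
qed

end

section \<open>Eigenvectors over \<open>L\<close>: complements, pairing, and an anisotropic
  eigenvector\<close>

context
  fixes L
  assumes L: "quadratic_etale L"
begin

lemma L_subspace: "subspace L"
  by (rule L_closed(1)[OF L])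

lemma L_orth_zero:
  assumes "x \<in> L" "x \<in> orth L"
  shows "x = 0"
  using L_nondegenerate[OF L] assms by (auto simp: nondegenerate_on_def orth_iff)

lemma L_split:
  obtains l where "l \<in> L" "x - l \<in> orth L"
  using orthogonal_projection[OF L_subspace L_nondegenerate[OF L]] .

lemma orth_diff: "x \<in> orth L \<Longrightarrow> y \<in> orth L \<Longrightarrow> x - y \<in> orth L"
  by (rule subspace_diff[OF subspace_orth])

lemma orth_L_mul: "b \<in> L \<Longrightarrow> x \<in> orth L \<Longrightarrow> b \<star> x \<in> orth L"
  by (rule orth_mul[OF L_subalgebra[OF L]])

context
  fixes e
  assumes e: "e \<in> L" "nontrivial_idempotent e"
begin

lemma idempotent_norm: "N e = 0" and idempotent_conj: "conj e = e1 - e"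
proof -
  have ee: "e \<star> e = e" "e \<noteq> 0" "e \<noteq> e1" using e by (auto simp: nontrivial_idempotent_def)
  have 1: "N e *\<^sub>k e = N e *\<^sub>k e1"
    using conj_mul_cancel[of e e] conj_mul_self[of e] ee(1) by auto
  then show Ne: "N e = 0" using ee by auto
  have "(tr e - 1) *\<^sub>k e = 0"
    using quadratic_relation[of e] ee(1) Ne by (simp add: scale_left_diff_distrib)
  then have "tr e = 1" using ee by simp
  then show "conj e = e1 - e" by (simp add: conj_def)
qed

text \<open>Let \<open>l\<close> be the component of \<open>u\<close> in \<open>L\<close>. From
  \<open>e \<star> u = 0\<close> follows \<open>e \<star> l = 0\<close>. On \<open>orth L\<close>
  right multiplication by \<open>e\<close> is left multiplication by \<open>e1 - e\<close>, and
  comparing both on \<open>u - l\<close> forces \<open>l = 0\<close>.\<close>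

lemma U_space_orth:
  assumes "u \<in> U_space e"
  shows "u \<in> orth L"
proof -
  have u: "e \<star> u = 0" "u \<star> e = u" using assms by (auto simp: U_space_def)
  obtain l where l: "l \<in> L" "u - l \<in> orth L" by (rule L_split)
  have "e \<star> (u - l) = - (e \<star> l)" using u by (simp add: mul_diff_right)
  then have el: "e \<star> l = 0"
    using L_orth_zero[of "e \<star> (u - l)"] orth_L_mul[OF e(1) l(2)] l(1) e(1) by (simp add: L_closed[OF L])
  have "(u - l) \<star> e = conj e \<star> (u - l)"
    using orth_swap[OF L_subalgebra[OF L] l(2), of "conj e"] e by (simp add: L_closed[OF L])
  then have "u - l = u - l - l"
    using u el L_commute[OF L e(1) l(1)] by (simp add: mul_distribs idempotent_conj)
  then have "l = 0" by simp
  then show ?thesis using l by simp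
qed

end

context
  fixes t
  assumes t: "t \<in> Aut" and fix_L: "\<And>x. x \<in> L \<Longrightarrow> t x = x"
begin

lemma t_L_linear: "b \<in> L \<Longrightarrow> t (b \<star> x) = b \<star> t x"
  by (simp add: AutD[OF t] fix_L)

lemma t_orth: "x \<in> orth L \<Longrightarrow> t x \<in> orth L"
  using Aut_polar[OF t, of x] by (auto simp: orth_iff fix_L) (metis fix_L)

text \<open>
  The hypothesis \<open>semisimple\<close> is the part of semisimplicity that survives restriction of scalars from
  \<open>L\<close> to \<open>k\<close>: it says nothing about polynomials over \<open>L\<close>, and the lemma recovers the statement for
  \<open>X - b\<close> from the minimal polynomial of \<open>b\<close> over \<open>k\<close>.
\<close>

lemma eigenspace_complement:
  assumes semisimple: "\<And>\<rho> \<tau> \<nu> x. let S = \<lambda>x. \<rho> *\<^sub>k t (t x) - \<tau> *\<^sub>k t x + \<nu> *\<^sub>k x in S (S x) = 0 \<longrightarrow> S x = 0"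
    and b: "b \<in> L"
  shows "\<exists>z. t (y - (t z - b \<star> z)) = b \<star> (y - (t z - b \<star> z))"
proof -
  define T where "T x = t x - b \<star> x" for x
  define T' where "T' x = t x - conj b \<star> x" for x
  have T_lin: "Vector_Spaces.linear scale scale T"
    by (rule linearI) (simp_all add: T_def AutD[OF t] mul_distribs algebra_simps scale_right_diff_distrib)
  obtain \<gamma> where \<gamma>: "\<gamma> \<in> L" "tr \<gamma> = 0" "N \<gamma> \<noteq> 0" "\<And>x. x \<in> L \<Longrightarrow> \<exists>a b. x = a *\<^sub>k e1 + b *\<^sub>k \<gamma>"
    by (rule quadratic_generator[OF L]) blast
  obtain b0 b1 where b01: "b = b0 *\<^sub>k e1 + b1 *\<^sub>k \<gamma>" using \<gamma>(4)[OF b] by blast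
  have cb: "conj b \<in> L" using b by (rule L_closed[OF L])
  have ker: "T x = 0" if TT: "T (T x) = 0" for x
  proof (cases "b1 = 0")
    case True
    \<comment> \<open>For scalar \<open>b\<close> the map \<open>T\<close> is itself a polynomial in
      \<open>t\<close> over \<open>k\<close>, of degree 1; hence the leading coefficient 0.\<close>
    have "T x = 0 *\<^sub>k t (t x) - (-1) *\<^sub>k t x + (- b0) *\<^sub>k x" for x
      by (simp add: T_def b01 True)
    then show ?thesis using TT semisimple[of 0 "-1" "- b0" x] by (simp add: Let_def)
  next
    case False
    \<comment> \<open>\<open>T'\<close> and \<open>T\<close> multiply to the quadratic polynomial of
      \<open>b\<close> over \<open>k\<close> applied to \<open>t\<close>, to which semisimplicity
      applies.\<close>
    have com: "T' (T x) = T (T' x)" "T' (T x) = 1 *\<^sub>k t (t x) - tr b *\<^sub>k t x + N b *\<^sub>k x" for x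
    proof -
      have s: "b \<star> t x + conj b \<star> t x = tr b *\<^sub>k t x" for x
        by (simp add: conj_def mul_diff_left)
      show "T' (T x) = T (T' x)"
        using conj_mul_cancel[of b x] mul_conj_cancel[of b x]
        by (simp add: T_def T'_def AutD(6)[OF t] t_L_linear b cb mul_diff_right algebra_simps)
      show "T' (T x) = 1 *\<^sub>k t (t x) - tr b *\<^sub>k t x + N b *\<^sub>k x"
        using conj_mul_cancel[of b x]
        by (simp add: T_def T'_def AutD(6)[OF t] t_L_linear b cb mul_diff_right algebra_simps flip: s)
    qed
    have z: "T 0 = 0" "T' 0 = 0" by (simp_all add: T_def T'_def AutD[OF t])
    have "T' (T (T' (T x))) = 0" using TT by (simp add: com(1) z) (simp add: z flip: com(1))
    then have "T' (T x) = 0"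
      using semisimple[of 1 "tr b" "N b" x] com(2)[of x] com(2)[of "T' (T x)"]
      by (simp only: Let_def)
    \<comment> \<open>Now \<open>T x\<close> is killed by both \<open>T\<close> and
      \<open>T'\<close>, hence by \<open>b - conj b\<close>. This is a nonzero multiple of \<gamma>,
      which has nonzero norm and can be cancelled.\<close>
    then have "b \<star> T x - conj b \<star> T x = 0" using TT by (simp add: T_def[of "T x"] T'_def[of "T x"])
    then have "(b - conj b) \<star> T x = 0" by (simp add: mul_diff_left)
    moreover have "b - conj b = b1 *\<^sub>k \<gamma> + b1 *\<^sub>k \<gamma>"
      by (simp add: b01 conj_add conj_pure[OF \<gamma>(2)])
    then have "b - conj b = (2 * b1) *\<^sub>k \<gamma>"
      by (simp only: mult_2 scale_left_distrib)
    ultimately have "(2 * b1) *\<^sub>k (\<gamma> \<star> T x) = 0" by simp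
    then have "\<gamma> \<star> T x = 0" using False two_neq_zero by simp
    then show ?thesis using conj_mul_cancel[of \<gamma> "T x"] \<gamma>(3) by simp
  qed
  \<comment> \<open>Kernel and range of \<open>T\<close> meet trivially, so \<open>T\<close> is
    bijective on its range. Hence \<open>T y = T (T z)\<close> for some \<open>z\<close>, and
    \<open>y - T z\<close> is in the kernel.\<close>
  have "T ` range T = range T"
  proof (rule linear_on_subspace_surj[OF T_lin])
    interpret T: Vector_Spaces.linear scale scale T by (fact T_lin)
    show "subspace (range T)" by (rule T.subspace_image) simp
    show "T ` range T \<subseteq> range T" by auto
    show "x = 0" if "x \<in> range T" "T x = 0" for x using that ker by auto
  qed
  then obtain z where "T y = T (T z)" by (metis imageE rangeI)
  moreover have "T (x - x') = T x - T x'" for x x'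
    by (simp add: T_def AutD(6)[OF t] mul_diff_right)
  ultimately have "T (y - T z) = 0" by simp
  then show ?thesis by (auto simp: T_def)
qed

text \<open>The eigenvalue \<open>b = a / N a\<close> is the inverse of \<open>conj a\<close>.
  Because \<open>t\<close> is an isometry, \<open>v\<close> is orthogonal to the image of
  \<open>t - b\<close>. As this image and the kernel of \<open>t - b\<close> together span
  everything, some kernel vector pairs nontrivially with \<open>v\<close>; its component in
  \<open>L\<close> is then removed.\<close>

lemma paired_eigenvector:
  assumes semisimple: "\<And>\<rho> \<tau> \<nu> x. let S = \<lambda>x. \<rho> *\<^sub>k t (t x) - \<tau> *\<^sub>k t x + \<nu> *\<^sub>k x in S (S x) = 0 \<longrightarrow> S x = 0"
    and a: "a \<in> L" "N a \<noteq> 0" and v: "v \<in> orth L" "v \<noteq> 0" and eigen: "t v = a \<star> v"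
  obtains v' where "v' \<in> orth L" "t v' = ((1 / N a) *\<^sub>k a) \<star> v'" "polar v v' \<noteq> 0"
proof -
  define b where "b = (1 / N a) *\<^sub>k a"
  have b: "b \<in> L" using a by (simp add: b_def L_closed[OF L])
  obtain y where y: "polar v y \<noteq> 0" using polar_nondegenerate v(2) by blast
  obtain z where z: "t (y - (t z - b \<star> z)) = b \<star> (y - (t z - b \<star> z))"
    using eigenspace_complement[OF semisimple b] by blast
  define v0 where "v0 = y - (t z - b \<star> z)"
  have "t (conj b \<star> v) = v"
    using conj_mul_cancel[of a v] a by (simp add: t_L_linear eigen L_closed[OF L] b_def AutD(2)[OF t])
  then have "polar v (t z) = polar (conj b \<star> v) z"
    using Aut_polar[OF t, of "conj b \<star> v" z] by simp
  also have "\<dots> = polar v (b \<star> z)" by (simp add: polar_adjoint_left)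
  finally have "polar v v0 \<noteq> 0" using y by (simp add: v0_def polar_diff_right)
  obtain l where l: "l \<in> L" "v0 - l \<in> orth L" by (rule L_split)
  define v' where "v' = v0 - l"
  have "t v' - b \<star> v' = b \<star> l - l"
    using z by (simp add: v'_def AutD[OF t] fix_L l(1) mul_diff_right flip: v0_def)
  moreover have "b \<star> l - l \<in> L" using b l(1) by (simp add: L_closed[OF L])
  moreover have "t v' - b \<star> v' \<in> orth L"
    using l(2) b by (simp add: v'_def orth_diff t_orth orth_L_mul)
  ultimately have "t v' = b \<star> v'" using L_orth_zero[of "t v' - b \<star> v'"] by simp
  moreover have "polar v v' \<noteq> 0"
    using \<open>polar v v0 \<noteq> 0\<close> v(1) l(1) by (simp add: v'_def polar_diff_right orth_iff)
  ultimately show thesis using that[of v'] l(2) by (simp add: v'_def b_def)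
qed

lemma Aut_nonzero: "x \<noteq> 0 \<Longrightarrow> t x \<noteq> 0"
  using AutD(5,8)[OF t] by (metis bij_is_inj injD)

text \<open>
  If the eigenvector \<open>v\<close> is isotropic and \<open>v'\<close> is an eigenvector paired with it, the third eigenvector
  is their cross product, that is the component of \<open>v v'\<close> orthogonal to \<open>L\<close>.
\<close>

proposition reversible_if_eigenvector_field:
  assumes semisimple: "\<And>\<rho> \<tau> \<nu> x. let S = \<lambda>x. \<rho> *\<^sub>k t (t x) - \<tau> *\<^sub>k t x + \<nu> *\<^sub>k x in S (S x) = 0 \<longrightarrow> S x = 0"
    and aniso: "\<And>x. x \<in> L \<Longrightarrow> x \<noteq> 0 \<Longrightarrow> N x \<noteq> 0"
    and a: "a \<in> L" and v: "v \<in> orth L" "v \<noteq> 0" and eigen: "t v = a \<star> v"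
  shows "reversible t"
proof (cases "N v = 0")
  case False
  then show ?thesis
    using reversible_if_anisotropic_eigenvector[OF L t fix_L v(1) _ a eigen] by blast
next
  case True
  have "a \<noteq> 0" using Aut_nonzero[OF v(2)] eigen by auto
  then have Na: "N a \<noteq> 0" using aniso a by blast
  define b where "b = (1 / N a) *\<^sub>k a"
  have b: "b \<in> L" "conj b \<in> L" "conj a \<in> L" using a by (simp_all add: b_def L_closed[OF L])
  obtain v' where v': "v' \<in> orth L" "t v' = b \<star> v'" "polar v v' \<noteq> 0"
    using paired_eigenvector[OF semisimple a Na v eigen] unfolding b_def by blast
  obtain l where l: "l \<in> L" "v \<star> v' - l \<in> orth L" by (rule L_split)
  define n where "n = v \<star> v' - l"
  have n: "n \<in> orth L" using l by (simp add: n_def)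
  \<comment> \<open>Moving \<open>a\<close> past \<open>b \<star> v'\<close> and \<open>b\<close>
    past \<open>v\<close> is allowed by orthogonality and conjugates \<open>b\<close>. On the
    component \<open>n\<close> in \<open>orth L\<close> the right factor \<open>a\<close> then
    becomes a left factor \<open>conj a\<close>.\<close>
  have "t (v \<star> v') = (a \<star> v) \<star> (b \<star> v')" by (simp add: AutD[OF t] eigen v')
  also have "\<dots> = (v \<star> (b \<star> v')) \<star> a"
    using mul_mul_conj[of v "conj a" "b \<star> v'"] orth_swap[OF L_subalgebra[OF L] v(1) a]
      orth_conj[OF L_subalgebra[OF L] orth_L_mul[OF b(1) v'(1)]]
      orth_polar(2)[OF L_subalgebra[OF L] orth_L_mul[OF b(1) v'(1)] b(3)]
    by simp
  also have "v \<star> (b \<star> v') = conj b \<star> (v \<star> v')"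
    using conj_mul_mul[of v b v'] orth_conj[OF L_subalgebra[OF L] v(1)]
      orth_polar(1)[OF L_subalgebra[OF L] v(1) b(1)] by simp
  also have "(conj b \<star> (v \<star> v')) \<star> a = (conj b \<star> l) \<star> a + (conj b \<star> n) \<star> a"
    by (simp add: n_def mul_distribs)
  also have "(conj b \<star> n) \<star> a = (conj a \<star> conj b) \<star> n"
    using orth_swap[OF L_subalgebra[OF L] orth_L_mul[OF b(2) n] b(3)] L_module[OF L b(3,2)] by simp
  finally have "t n - (conj a \<star> conj b) \<star> n = (conj b \<star> l) \<star> a - l"
    by (simp add: n_def AutD[OF t] fix_L l(1) algebra_simps)
  moreover have "(conj b \<star> l) \<star> a - l \<in> L" "conj a \<star> conj b \<in> L" using a b l by (simp_all add: L_closed[OF L])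
  moreover from this n have "t n - (conj a \<star> conj b) \<star> n \<in> orth L"
    by (simp add: orth_diff t_orth orth_L_mul)
  ultimately have tn: "t n = (conj a \<star> conj b) \<star> n"
    using L_orth_zero[of "t n - (conj a \<star> conj b) \<star> n"] by simp
  \<comment> \<open>The pairing of \<open>v\<close> and \<open>v'\<close> is minus the trace of
    \<open>l\<close>, so \<open>l\<close> is nonzero. As \<open>v\<close> is isotropic, so is the
    product, whence \<open>N n = - N l\<close>, and this is nonzero because \<open>L\<close> is
    anisotropic.\<close>
  have "tr (v \<star> v') = - polar v v'"
    using polar_adjoint_right[of v v' e1] orth_conj[OF L_subalgebra[OF L] v'(1)] by (simp add: tr_def)
  moreover have "tr n = 0" by (rule orth_tr[OF L_subalgebra[OF L] n])
  ultimately have "l \<noteq> 0" using v'(3) by (auto simp: n_def)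
  moreover have "N l + N n = 0"
    using N_add[of l n] orth_polar(2)[OF L_subalgebra[OF L] n l(1)] True by (simp add: n_def N_mult)
  ultimately have "N n \<noteq> 0" using aniso[OF l(1)] by auto
  then show ?thesis
    using reversible_if_anisotropic_eigenvector[OF L t fix_L n _ \<open>conj a \<star> conj b \<in> L\<close> tn] by blast
qed

context
  fixes e
  assumes e: "e \<in> L" "nontrivial_idempotent e"
begin

proposition reversible_if_eigenvector_split:
  assumes semisimple: "\<And>\<rho> \<tau> \<nu> x. let S = \<lambda>x. \<rho> *\<^sub>k t (t x) - \<tau> *\<^sub>k t x + \<nu> *\<^sub>k x in S (S x) = 0 \<longrightarrow> S x = 0"
    and u: "u \<in> U_space e" "u \<noteq> 0" and eigen: "t u = \<mu> *\<^sub>k u"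
  shows "reversible t"
proof -
  have ee: "e \<star> e = e" using e by (auto simp: nontrivial_idempotent_def)
  have eu: "e \<star> u = 0" "u \<star> e = u" using u by (auto simp: U_space_def)
  have uL: "u \<in> orth L" using u(1) by (rule U_space_orth[OF e])
  have \<mu>: "\<mu> \<noteq> 0" using Aut_nonzero[OF u(2)] eigen by auto
  have N\<mu>: "N (\<mu> *\<^sub>k e1) = \<mu> * \<mu>" by (simp add: N_scale power2_eq_square)
  \<comment> \<open>The scalar \<mu> is used as the element \<open>\<mu> *\<^sub>k e1\<close> of
    \<open>L\<close>, whose norm is the square of \<mu>; hence the paired eigenvalue
    \<open>1 / \<mu>\<close>.\<close>
  obtain v' where v': "v' \<in> orth L" "t v' = (1 / \<mu>) *\<^sub>k v'" "polar u v' \<noteq> 0"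
    using paired_eigenvector[OF semisimple _ _ uL u(2), of "\<mu> *\<^sub>k e1"] \<mu> eigen
    by (auto simp: L_closed[OF L] N\<mu>)
  \<comment> \<open>Multiplying by \<open>e\<close> keeps the eigenvalue, makes the vector
    isotropic, and preserves the pairing with \<open>u\<close> since
    \<open>conj e \<star> u = u\<close>. So \<open>N (u + w)\<close> is just
    \<open>polar u w\<close>.\<close>
  define w where "w = e \<star> v'"
  have w: "w \<in> orth L" "t w = (1 / \<mu>) *\<^sub>k w" "e \<star> w = w"
    using L_module[OF L e(1) e(1), of v'] v' e(1) ee by (simp_all add: w_def orth_L_mul t_L_linear)
  have "polar u w = polar v' u"
    using polar_adjoint_left[of e v' u] eu(1)
    by (simp add: w_def idempotent_conj[OF e] mul_diff_left polar_commute[of u])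
  then have "polar u w \<noteq> 0" using v'(3) by (simp add: polar_commute)
  moreover have "N u = 0" using N_mult[of u e] eu(2) by (simp add: idempotent_norm[OF e])
  ultimately have "N (u + w) \<noteq> 0"
    by (simp add: N_add) (simp add: w_def N_mult idempotent_norm[OF e])
  moreover have "\<mu> *\<^sub>k (e1 - e) + (1 / \<mu>) *\<^sub>k e \<in> L" using e(1) by (simp add: L_closed[OF L])
  \<comment> \<open>\<open>e\<close> annihilates \<open>u\<close> and fixes \<open>w\<close>, so
    different scalars on the two idempotents act as one element of \<open>L\<close> on the
    sum.\<close>
  moreover have "t (u + w) = (\<mu> *\<^sub>k (e1 - e) + (1 / \<mu>) *\<^sub>k e) \<star> (u + w)"
    using eu w by (simp add: AutD[OF t] eigen mul_distribs)
  moreover have "u + w \<in> orth L" using uL w(1) subspace_orth by (simp add: subspace_add)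
  ultimately show ?thesis using reversible_if_anisotropic_eigenvector[OF L t fix_L] by blast
qed

end
end
end

section \<open>Dimension bounds and the two cases of the theorem\<close>

lemma card_family_le_dim:
  assumes I: "finite I" and x: "\<And>i. i \<in> I \<Longrightarrow> x i \<in> B"
    and indep: "\<And>c i. (\<Sum>i\<in>I. c i *\<^sub>k x i) = 0 \<Longrightarrow> i \<in> I \<Longrightarrow> c i = 0"
  shows "card I \<le> dim B"
proof -
  have inj: "inj_on x I"
  proof (rule inj_onI, rule ccontr)
    fix i j assume ij: "i \<in> I" "j \<in> I" "x i = x j" "i \<noteq> j"
    \<comment> \<open>The difference of two unit coefficient vectors would be a nontrivial relation
      if the family repeated a vector.\<close>
    define c where "c l = (if l = i then 1 else 0) - (if l = j then 1 else (0::'k))" for l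
    have "(\<Sum>l\<in>I. c l *\<^sub>k x l) = (\<Sum>l\<in>I. if l = i then x i else 0) - (\<Sum>l\<in>I. if l = j then x j else 0)"
      unfolding sum_subtractf[symmetric] by (intro sum.cong) (auto simp: c_def)
    also have "\<dots> = 0" using I ij by simp
    finally have "c i = 0" using indep ij(1) by blast
    then show False using ij by (simp add: c_def)
  qed
  have "independent (x ` I)"
  proof (rule independent_if_scalars_zero)
    show "finite (x ` I)" using I by simp
    fix f v assume "(\<Sum>v\<in>x ` I. f v *\<^sub>k v) = 0" "v \<in> x ` I"
    then show "f v = 0" using indep[of "\<lambda>i. f (x i)"] by (auto simp: sum.reindex[OF inj])
  qed
  then have "card (x ` I) \<le> dim B" using x by (intro fd.independent_card_le_dim) auto
  then show ?thesis by (simp add: card_image[OF inj])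
qed

context
  fixes L
  assumes L: "quadratic_etale L"
begin

lemma dim_orth_le: "dim (orth L) \<le> 6"
proof -
  have "L \<inter> orth L = {0}"
    using L_orth_zero[OF L] L_closed(3)[OF L] subspace_0[OF subspace_orth] by blast
  then have "dim {x + y |x y. x \<in> L \<and> y \<in> orth L} = 2 + dim (orth L)"
    using fd.dim_sums_Int[OF L_closed(1)[OF L] subspace_orth, of L] dim_L[OF L] by simp
  moreover have "dim {x + y |x y. x \<in> L \<and> y \<in> orth L} \<le> dim UNIV" by (rule fd.dim_subset) simp
  ultimately show ?thesis using dim_8 by simp
qed

text \<open>Each index contributes two vectors to a space of dimension at most 6. The pairs are a
  basis vector and its multiple by \<gamma> if \<open>L\<close> is a field, and a basis vector of
  the isotropic space with its dual vector if \<open>L\<close> is split.\<close>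

lemma pairs_in_orth_le:
  fixes n :: nat
  assumes y: "\<And>i. i < n \<Longrightarrow> y i \<in> orth L" and z: "\<And>i. i < n \<Longrightarrow> z i \<in> orth L"
    and indep: "\<And>c d i. (\<Sum>i<n. c i *\<^sub>k y i + d i *\<^sub>k z i) = 0 \<Longrightarrow> i < n \<Longrightarrow> c i = 0 \<and> d i = 0"
  shows "n \<le> 3"
proof -
  have "card ({..<n} \<times> (UNIV :: bool set)) \<le> dim (orth L)"
  proof (rule card_family_le_dim[where x = "\<lambda>(i, b). if b then z i else y i"])
    show "finite ({..<n} \<times> (UNIV :: bool set))" by (rule finite_cartesian_product) simp_all
    show "(case p of (i, b) \<Rightarrow> if b then z i else y i) \<in> orth L" if "p \<in> {..<n} \<times> UNIV" for p
      using that y z by auto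
    fix c p assume s: "(\<Sum>p\<in>{..<n} \<times> (UNIV :: bool set). c p *\<^sub>k (case p of (i, b) \<Rightarrow> if b then z i else y i)) = 0"
      and p: "p \<in> {..<n} \<times> (UNIV :: bool set)"
    have "(\<Sum>i<n. c (i, False) *\<^sub>k y i + c (i, True) *\<^sub>k z i) = 0"
      using s by (simp add: sum.cartesian_product' UNIV_bool add.commute split_def)
    from indep[OF this, of "fst p"] p show "c p = 0" by (cases p; cases "snd p") auto
  qed
  then show ?thesis using dim_orth_le by simp
qed

lemma subalgebra_ring_simps:
  "carrier (subalgebra_ring L) = L" "monoid.mult (subalgebra_ring L) = (\<star>)"
  "one (subalgebra_ring L) = e1" "ring.zero (subalgebra_ring L) = 0" "add (subalgebra_ring L) = (+)"
  by (simp_all add: subalgebra_ring_def)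

lemma field_anisotropic:
  assumes F: "field (subalgebra_ring L)" and x: "x \<in> L" "x \<noteq> 0"
  shows "N x \<noteq> 0"
proof -
  have "x \<in> Units (subalgebra_ring L)" using x field.field_Units[OF F] by (simp add: subalgebra_ring_simps)
  then obtain y where "x \<star> y = e1" by (auto simp: Units_def subalgebra_ring_simps)
  then show ?thesis using N_mult[of x y] by auto
qed

text \<open>\<gamma> has square \<open>- N \<gamma>\<close>, so it is sent to a square root of that
  scalar. The embedding supplies the field that is a type, as
  \<open>reducible_char_poly_eigenvalue\<close> requires.\<close>

lemma embedding_into_closure:
  obtains h where "h \<in> Ring.ring_hom (subalgebra_ring L) (class_ring :: 'k alg_closure ring)"
proof -
  obtain \<gamma> where \<gamma>: "\<gamma> \<in> L" "tr \<gamma> = 0" "N \<gamma> \<noteq> 0" "\<And>x. x \<in> L \<Longrightarrow> \<exists>a b. x = a *\<^sub>k e1 + b *\<^sub>k \<gamma>"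
    by (rule quadratic_generator[OF L]) blast
  obtain r :: "'k alg_closure" where r: "r ^ 2 = to_ac (- N \<gamma>)"
    using nth_root_exists[of 2 "to_ac (- N \<gamma>)"] by auto
  \<comment> \<open>For \<open>x = a *\<^sub>k e1 + b *\<^sub>k \<gamma>\<close> the trace is
    \<open>2 a\<close> and the pairing with \<gamma> is \<open>2 b N \<gamma>\<close>, so the two
    quotients are \<open>a\<close> and \<open>b\<close>.\<close>
  define h where "h x = to_ac (tr x / 2) + to_ac (polar x \<gamma> / (2 * N \<gamma>)) * r" for x
  have h: "h (a *\<^sub>k e1 + b *\<^sub>k \<gamma>) = to_ac a + to_ac b * r" for a b
    using \<gamma> two_neq_zero
    by (simp add: h_def tr_add polar_add_left polar_self polar_commute[of e1] flip: tr_def del: to_ac_divide)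
  have \<gamma>\<gamma>: "\<gamma> \<star> \<gamma> = - (N \<gamma> *\<^sub>k e1)" using pure_square[OF \<gamma>(2), of e1] by simp
  have "h \<in> Ring.ring_hom (subalgebra_ring L) (class_ring :: 'k alg_closure ring)"
  proof (rule ring_hom_memI; simp add: subalgebra_ring_simps)
    fix x y assume x: "x \<in> L" and y: "y \<in> L"
    obtain a b c d where ab: "x = a *\<^sub>k e1 + b *\<^sub>k \<gamma>" and cd: "y = c *\<^sub>k e1 + d *\<^sub>k \<gamma>"
      using \<gamma>(4)[OF x] \<gamma>(4)[OF y] by blast
    have "x + y = (a + c) *\<^sub>k e1 + (b + d) *\<^sub>k \<gamma>"
      by (simp add: ab cd scale_left_distrib)
    then have "h (x + y) = to_ac (a + c) + to_ac (b + d) * r" by (simp only: h)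
    then show "h (x + y) = h x + h y" unfolding ab cd h by (simp add: algebra_simps)
    have "x \<star> y = (a * c - b * d * N \<gamma>) *\<^sub>k e1 + (a * d + b * c) *\<^sub>k \<gamma>"
      by (simp add: ab cd mul_distribs \<gamma>\<gamma> scale_left_distrib scale_left_diff_distrib scale_right_distrib
          algebra_simps)
    then have "h (x \<star> y) = to_ac (a * c - b * d * N \<gamma>) + to_ac (a * d + b * c) * r" by (simp only: h)
    also have "\<dots> = to_ac a * to_ac c + to_ac b * to_ac d * r ^ 2 + (to_ac a * to_ac d + to_ac b * to_ac c) * r"
      by (simp add: r)
    also have "\<dots> = h x * h y"
      unfolding ab cd h by (simp add: power2_eq_square algebra_simps)
    finally show "h (x \<star> y) = h x * h y" .
  next
    show "h e1 = 1" using h[of 1 0] by simp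
  qed
  then show thesis by (rule that)
qed

lemma vectorspace_orth:
  assumes F: "field (subalgebra_ring L)"
  shows "vectorspace (subalgebra_ring L) (additive_module mul (orth L))"
  by (rule additive_module_vectorspaceI[OF F])
    (use subspace_orth[of L] in \<open>auto simp: subalgebra_ring_simps mul_distribs L_module[OF L] orth_mul[OF L_subalgebra[OF L]]
      intro: subspace_add subspace_0 subspace_neg\<close>)

context
  fixes t
  assumes t: "t \<in> Aut" and fix_L: "\<And>x. x \<in> L \<Longrightarrow> t x = x"
begin

lemma fixed_point_of_nonsurjective:
  assumes "subspace V" "Vector_Spaces.linear scale scale f" "f ` V \<noteq> V" "f ` V \<subseteq> V"
  obtains v where "v \<in> V" "v \<noteq> 0" "f v = 0"
  using linear_on_subspace_surj[OF assms(2,1,4)] assms(3) by blast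

lemma reversible_field_case:
  assumes ss: "semisimple_endo scale t" and F: "field (subalgebra_ring L)"
    and p: "is_char_poly (subalgebra_ring L) mul (orth L) t p" "reducible_poly (subalgebra_ring L) p"
  shows "reversible t"
proof -
  let ?K = "subalgebra_ring L"
  obtain us A where rep: "represents ?K mul (orth L) t us A" and pA: "p = char_poly_over ?K A"
    using p(1) by (auto simp: is_char_poly_def)
  have us: "vectorspace.basis ?K (additive_module mul (orth L)) (set us)" "distinct us"
    using rep by (auto simp: represents_def)
  note V = vectorspace_orth[OF F]
  obtain \<gamma> where \<gamma>: "\<gamma> \<in> L" "tr \<gamma> = 0" "N \<gamma> \<noteq> 0" "\<And>x. x \<in> L \<Longrightarrow> \<exists>a b. x = a *\<^sub>k e1 + b *\<^sub>k \<gamma>"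
    by (rule quadratic_generator[OF L]) blast
  have us_in: "us ! i \<in> orth L" if "i < length us" for i using basis_in[OF V us that] .
  \<comment> \<open>\<open>is_char_poly\<close> leaves the length of the basis open, and this bound
    is what makes the polynomial at most cubic.\<close>
  have "length us \<le> 3"
  proof (rule pairs_in_orth_le)
    show "us ! i \<in> orth L" "\<gamma> \<star> us ! i \<in> orth L" if "i < length us" for i
      using us_in[OF that] orth_mul[OF L_subalgebra[OF L] _ \<gamma>(1)] by auto
    fix c d i assume s: "(\<Sum>i<length us. c i *\<^sub>k us ! i + d i *\<^sub>k (\<gamma> \<star> us ! i)) = 0" and i: "i < length us"
    have "(\<Sum>i<length us. (c i *\<^sub>k e1 + d i *\<^sub>k \<gamma>) \<star> us ! i) = 0"
      using s by (simp add: mul_add_left)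
    then have z: "c i *\<^sub>k e1 + d i *\<^sub>k \<gamma> = 0"
      using basis_independent[OF V us, of "\<lambda>i. c i *\<^sub>k e1 + d i *\<^sub>k \<gamma>" i] i \<gamma>(1)
      by (simp add: subalgebra_ring_simps L_closed[OF L])
    have "tr (c i *\<^sub>k e1 + d i *\<^sub>k \<gamma>) = 2 * c i" using \<gamma>(2) by (simp add: tr_add)
    then have "c i = 0" using z two_neq_zero by simp
    then show "c i = 0 \<and> d i = 0" using z \<gamma>(3) by auto
  qed
  moreover obtain h where "h \<in> Ring.ring_hom ?K (class_ring :: 'k alg_closure ring)"
    by (rule embedding_into_closure)
  ultimately have "\<exists>a\<in>carrier ?K. (\<lambda>x. t x - a \<star> x) ` orth L \<noteq> orth L"
    using p(2) pA
    by (intro reducible_char_poly_eigenvalue[OF F V _ rep])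
      (auto simp: AutD[OF t] fix_L subalgebra_ring_simps)
  then obtain a where a: "a \<in> L" "(\<lambda>x. t x - a \<star> x) ` orth L \<noteq> orth L"
    by (auto simp: subalgebra_ring_simps)
  have "(\<lambda>x. t x - a \<star> x) ` orth L \<subseteq> orth L"
    using a(1) by (auto intro!: orth_diff[OF L] t_orth[OF L t fix_L] orth_L_mul[OF L])
  moreover have "Vector_Spaces.linear scale scale (\<lambda>x. t x - a \<star> x)"
    by (rule linearI) (simp_all add: AutD[OF t] mul_distribs algebra_simps scale_right_diff_distrib)
  ultimately obtain v where v: "v \<in> orth L" "v \<noteq> 0" "t v - a \<star> v = 0"
    using fixed_point_of_nonsurjective[OF subspace_orth _ a(2)] by blast
  have "Vector_Spaces.linear scale scale t" using t by (simp add: Aut_def)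
  note kernel = semisimple_endo_quadratic_kernel[OF this ss]
  from v(3) have eigen: "t v = a \<star> v" by simp
  show ?thesis
    by (rule reversible_if_eigenvector_field[OF L t])
      (assumption | rule fix_L kernel field_anisotropic[OF F] a(1) v(1,2) eigen)+
qed

lemma reversible_split_case:
  assumes ss: "semisimple_endo scale t" and e: "e \<in> L" "nontrivial_idempotent e"
    and p: "is_char_poly class_ring scale (U_space e) t p" "reducible_poly class_ring p"
  shows "reversible t"
proof -
  let ?K = "class_ring :: 'k ring"
  obtain us A where rep: "represents ?K scale (U_space e) t us A" and pA: "p = char_poly_over ?K A"
    using p(1) by (auto simp: is_char_poly_def)
  have us: "vectorspace.basis ?K (additive_module scale (U_space e)) (set us)" "distinct us"
    using rep by (auto simp: represents_def)
  have sub: "subspace (U_space e)"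
    by (auto simp: subspace_def U_space_def mul_distribs)
  have V: "vectorspace ?K (additive_module scale (U_space e))"
    by (rule vector_space_additive_module[OF vector_space_axioms])
      (use sub in \<open>auto intro: subspace_0 subspace_add subspace_scale\<close>)
  have us_in: "us ! i \<in> U_space e" if "i < length us" for i using basis_in[OF V us that] .
  note U_orth = U_space_orth[OF L e]
  have isotropic: "N u = 0" if "u \<in> U_space e" for u
    using that N_mult[of u e] idempotent_norm[OF L e] by (auto simp: U_space_def)
  have U_polar: "polar u u' = 0" if "u \<in> U_space e" "u' \<in> U_space e" for u u'
    using isotropic[OF that(1)] isotropic[OF that(2)] isotropic[OF subspace_add[OF sub that]]
    by (simp add: polar_def)
  have us_indep: "c i = 0" if "(\<Sum>i<length us. c i *\<^sub>k us ! i) = 0" "i < length us" for c i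
    using basis_independent[OF V us, of c i] that by simp
  have "independent (set us)"
  proof (rule independent_if_scalars_zero)
    fix f v assume s: "(\<Sum>v\<in>set us. f v *\<^sub>k v) = 0" and v: "v \<in> set us"
    have "(\<Sum>i<length us. f (us ! i) *\<^sub>k us ! i) = (\<Sum>v\<in>set us. f v *\<^sub>k v)"
      by (rule sum.reindex_bij_betw) (rule bij_betw_nth[OF us(2)], auto)
    then show "f v = 0" using us_indep[of "\<lambda>i. f (us ! i)"] s v by (auto simp: in_set_conv_nth)
  qed simp
  \<comment> \<open>\<open>U_space e\<close> is totally isotropic, so its dimension is bounded by
    finding a dual family in \<open>orth L\<close>. Removing the component in \<open>L\<close> does
    not change pairings with \<open>U_space e\<close>, which lies in \<open>orth L\<close>.\<close>
  have dual: "\<exists>w\<in>orth L. \<forall>j<length us. polar w (us ! j) = (if i = j then 1 else 0)"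
    if i: "i < length us" for i
  proof -
    interpret pair: vector_space_pair scale "(*) :: 'k \<Rightarrow> 'k \<Rightarrow> 'k"
      using linear_polar[of 0] by (simp add: vector_space_pair_def Vector_Spaces.linear_def)
    obtain g where g: "Vector_Spaces.linear scale (*) g" "\<And>v. v \<in> set us \<Longrightarrow> g v = (if v = us ! i then 1 else 0)"
      using pair.linear_independent_extend[OF \<open>independent (set us)\<close>, of "\<lambda>v. if v = us ! i then 1 else 0"] by blast
    have "nondegenerate_on UNIV" using polar_nondegenerate by (auto simp: nondegenerate_on_def)
    then obtain x where x: "\<And>y. polar x y = g y" using polar_represents[OF subspace_UNIV _ g(1)] by blast
    obtain l where l: "l \<in> L" "x - l \<in> orth L" by (rule L_split[OF L])
    have "polar (x - l) (us ! j) = (if i = j then 1 else 0)" if j: "j < length us" for j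
      using U_orth[OF us_in[OF j]] l(1) g(2)[of "us ! j"] j i us(2)
      by (auto simp: polar_diff_left x polar_commute[of l] orth_iff nth_eq_iff_index_eq)
    then show ?thesis using l(2) by blast
  qed
  then obtain w where w: "\<And>i. i < length us \<Longrightarrow> w i \<in> orth L"
    "\<And>i j. i < length us \<Longrightarrow> j < length us \<Longrightarrow> polar (w i) (us ! j) = (if i = j then 1 else 0)"
    by metis
  have "length us \<le> 3"
  proof (rule pairs_in_orth_le)
    show "us ! i \<in> orth L" "w i \<in> orth L" if "i < length us" for i
      using U_orth[OF us_in[OF that]] w(1)[OF that] by auto
    fix c d i assume s: "(\<Sum>i<length us. c i *\<^sub>k us ! i + d i *\<^sub>k w i) = 0" and i: "i < length us"
    \<comment> \<open>Pairing with \<open>us ! j\<close> kills all terms in the isotropic space and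
      leaves \<open>d j\<close>.\<close>
    have d: "d j = 0" if j: "j < length us" for j
    proof -
      interpret pl: Vector_Spaces.linear scale "(*)" "polar (us ! j)" by (rule linear_polar)
      have "0 = polar (us ! j) (\<Sum>i<length us. c i *\<^sub>k us ! i + d i *\<^sub>k w i)" using s by simp
      also have "\<dots> = (\<Sum>i<length us. if i = j then d j else 0)"
        unfolding pl.sum using U_polar[OF us_in[OF j] us_in] w(2)[OF _ j]
        by (intro sum.cong) (auto simp: polar_add_right polar_commute[of "us ! j"])
      also have "\<dots> = d j" using j by simp
      finally show ?thesis by simp
    qed
    then have "(\<Sum>i<length us. c i *\<^sub>k us ! i) = 0" using s by simp
    then show "c i = 0 \<and> d i = 0" using us_indep[OF _ i] d[OF i] by blast
  qed
  moreover have id_hom: "id \<in> Ring.ring_hom ?K ?K" by (rule ring_hom_memI) auto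
  ultimately have "\<exists>a\<in>carrier ?K. (\<lambda>x. t x - a *\<^sub>k x) ` U_space e \<noteq> U_space e"
    using p(2) pA
    by (intro reducible_char_poly_eigenvalue[OF class_field V id_hom rep]) (auto simp: AutD[OF t])
  then obtain a where a: "(\<lambda>x. t x - a *\<^sub>k x) ` U_space e \<noteq> U_space e" by auto
  have "t u \<in> U_space e" if "u \<in> U_space e" for u
    using that AutD(3)[OF t, of e u] AutD(3)[OF t, of u e] fix_L[OF e(1)]
    by (auto simp: U_space_def AutD(8)[OF t])
  then have "(\<lambda>x. t x - a *\<^sub>k x) ` U_space e \<subseteq> U_space e"
    using sub by (auto intro: subspace_diff subspace_scale)
  moreover have "Vector_Spaces.linear scale scale (\<lambda>x. t x - a *\<^sub>k x)"
    by (rule linearI) (simp_all add: AutD[OF t] scale_right_distrib scale_right_diff_distrib mult.commute)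
  ultimately obtain u where u: "u \<in> U_space e" "u \<noteq> 0" "t u - a *\<^sub>k u = 0"
    using fixed_point_of_nonsurjective[OF sub _ a] by blast
  have "Vector_Spaces.linear scale scale t" using t by (simp add: Aut_def)
  note kernel = semisimple_endo_quadratic_kernel[OF this ss]
  from u(3) have eigen: "t u = a *\<^sub>k u" by simp
  show ?thesis
    by (rule reversible_if_eigenvector_split[OF L t])
      (assumption | rule fix_L kernel e u(1,2) eigen)+
qed

end
end
end

theorem theorem6p2:
  fixes scale :: "'k::field \<Rightarrow> 'c::ab_group_add \<Rightarrow> 'c"
    and mul :: "'c \<Rightarrow> 'c \<Rightarrow> 'c"
    and e1 :: 'c
    and N :: "'c \<Rightarrow> 'k"
    and t\<^sub>0 :: "'c \<Rightarrow> 'c"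
    and L :: "'c set"
  assumes "CHAR('k) \<noteq> 2"
    and "octonion_algebra scale mul e1 N"
    and "t\<^sub>0 \<in> octonion_algebra.Aut scale mul e1"
    and "semisimple_endo scale t\<^sub>0"
    and "octonion_algebra.quadratic_etale scale mul e1 N L"
    and "\<forall>x\<in>L. t\<^sub>0 x = x"
    and "(field (octonion_algebra.subalgebra_ring mul e1 L) \<and>
          (\<exists>p. is_char_poly (octonion_algebra.subalgebra_ring mul e1 L) mul
                 (octonion_algebra.orth N L) t\<^sub>0 p \<and>
               reducible_poly (octonion_algebra.subalgebra_ring mul e1 L) p))
       \<or> (octonion_algebra.split_algebra scale mul e1 L \<and>
          (\<exists>e\<in>L. octonion_algebra.nontrivial_idempotent mul e1 e \<and>
             (\<exists>p. is_char_poly class_ring scale (octonion_algebra.U_space mul e) t\<^sub>0 p \<and>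
                  reducible_poly class_ring p)))"
  shows "\<exists>g h. octonion_algebra.involution scale mul e1 g \<and>
               octonion_algebra.involution scale mul e1 h \<and> t\<^sub>0 = g \<circ> h"
proof -
  interpret octonion_algebra scale mul e1 N by fact
  have "(2::'k) \<noteq> 0"
  proof
    assume "(2::'k) = 0"
    then have "of_nat 2 = (0::'k)" by simp
    then have "CHAR('k) dvd 2" by (simp only: of_nat_eq_0_iff_char_dvd)
    then have "CHAR('k) = 1 \<or> CHAR('k) = 2" using prime_nat_iff two_is_prime_nat by blast
    then show False using assms(1) by simp
  qed
  then interpret octonion_algebra_char_not_2 scale mul e1 N by unfold_locales
  have "reversible t\<^sub>0"
    using assms(3-7) reversible_field_case[of L t\<^sub>0] reversible_split_case[of L t\<^sub>0] by blast
  then show ?thesis by (simp add: reversible_def)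
qed

end
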